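(* Let $\Omega\subset\mathbb{R}^N$ be a bounded $C^2$ domain, $k\in\{1,\dots,N\}$, and let $u$ satisfy $$\begin{cases}\mathcal{I}_k^+u\le0&\text{in }\Omega\\ u\ge0&\text{in }\mathbb{R}^N\setminus\Omega.\end{cases}$$ Assume $u\not\equiv0$ in $\Omega$. Then there exists a positive constant $c=c(\Omega,u)$ such that $u(x)\ge c\,d(x)^s$ for all $x\in\overline\Omega$.
   Context: Fix $s\in(0,1)$. $d(x)=\inf_{y\in\partial\Omega}|x-y|$ is the distance to $\partial\Omega$. Set $\delta(u,x,y)=u(x+y)+u(x-y)-2u(x)$, let $C_s=C_{1,s}>0$ be the normalizing constant of the one-dimensional fractional Laplacian, and let $\mathcal{V}_k$ be the family of $k$-dimensional orthonormal sets in $\mathbb{R}^N$. The operator is $\mathcal{I}_k^+u(x)=\sup_{\{\xi_i\}\in\mathcal{V}_k}\sum_{i=1}^k\mathcal{I}_{\xi_i}u(x)$, where $\mathcal{I}_\xi u(x)=C_s\int_0^{+\infty}\delta(u,x,\tau\xi)\tau^{-1-2s}\,d\tau$. The inequality $\mathcal{I}_k^+u\le0$ in $\Omega$ is in the viscosity sense: $u\in L^\infty(\mathbb{R}^N)\cap LSC(\Omega)$ (bounded measurable, defined at every point, lower semicontinuous in $\Omega$), and for every $x_0\in\Omega$, $\rho>0$ and $\varphi\in C^2(B_\rho(x_0))$ such that $x_0$ is a minimum point of $u-\varphi$ in $B_\rho(x_0)$, $$C_s\sup_{\{\xi_i\}\in\mathcal{V}_k}\sum_{i=1}^k\left(\int_0^\rho\frac{\delta(\varphi,x_0,\tau\xi_i)}{\tau^{1+2s}}\,d\tau+\int_\rho^{+\infty}\frac{\delta(u,x_0,\tau\xi_i)}{\tau^{1+2s}}\,d\tau\right)\le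 0.$$ *)

theory Defs
  imports "HOL-Analysis.Analysis"
begin

definition second_diff :: "('a::real_vector \<Rightarrow> real) \<Rightarrow> 'a \<Rightarrow> 'a \<Rightarrow> real" where
  "second_diff u x y = u (x + y) + u (x - y) - 2 * u x"

(* The constant for which the operator
   C * PV-integral of (v(x) - v(y)) / |x - y|^(1+2s) on the line
   has Fourier symbol |xi|^(2s). *)
definition frac_const :: "real \<Rightarrow> real" where
  "frac_const s = inverse (LBINT t. (1 - cos t) / \<bar>t\<bar> powr (1 + 2 * s))"

lemma frac_kernel_integrable:
  assumes "0 < s" "s < 1"
  shows "integrable lborel (\<lambda>t::real. (1 - cos t) / \<bar>t\<bar> powr (1 + 2 * s))"
proof -
  let ?h = "\<lambda>t::real. (1 - cos t) / \<bar>t\<bar> powr (1 + 2 * s)"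
  have [measurable]: "?h \<in> borel_measurable borel" by measurable
  have nn: "?h t \<ge> 0" for t by simp
  have A: "set_integrable lborel {0..1} ?h"
  proof -
    have "(\<lambda>t. t powr (1 - 2 * s)) integrable_on {0..1}"
      using assms integrable_on_powr_from_0[of "1 - 2 * s" 1] by simp
    hence "(\<lambda>t. t powr (1 - 2 * s)) absolutely_integrable_on {0..1}"
      by (intro nonnegative_absolutely_integrable_1) auto
    hence "set_integrable lborel {0..1} (\<lambda>t. t powr (1 - 2 * s))"
      unfolding set_integrable_def by (subst (asm) integrable_completion) auto
    thus ?thesis
    proof (rule set_integrable_bound)
      show "AE x in lborel. x \<in> {0..1} \<longrightarrow> norm (?h x) \<le> norm (x powr (1 - 2 * s))"
      proof (intro AE_I2 impI)
        fix x :: real assume x: "x \<in> {0..1}"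
        show "norm (?h x) \<le> norm (x powr (1 - 2 * s))"
        proof (cases "x = 0")
          case False
          have "cos x = 1 - 2 * (sin (x/2))\<^sup>2" using cos_double_sin[of "x/2"] by simp
          moreover have "(sin (x/2))\<^sup>2 \<le> (x/2)\<^sup>2"
            by (metis abs_le_square_iff abs_sin_x_le_abs_x)
          ultimately have "1 - cos x \<le> x\<^sup>2"
            using zero_le_power2[of x] by (simp add: power_divide, linarith)
          also have "x\<^sup>2 = x powr (1 - 2 * s) * x powr (1 + 2 * s)"
            using False x by (simp flip: powr_add powr_numeral)
          finally show ?thesis using False x by (simp add: divide_le_eq)
        qed auto
      qed
    qed (auto simp: set_borel_measurable_def)
  qed
  have B: "set_integrable lborel {1..} ?h"
  proof -
    have "(\<lambda>t. t powr (- 1 - 2 * s)) integrable_on {1..}"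
      using has_integral_powr_to_inf[of "- 1 - 2 * s" 1] assms
      unfolding integrable_on_def by auto
    hence "(\<lambda>t. 2 * t powr (- 1 - 2 * s)) integrable_on {1..}"
      by (rule integrable_on_mult_right)
    hence "(\<lambda>t. 2 * t powr (- 1 - 2 * s)) absolutely_integrable_on {1..}"
      by (intro nonnegative_absolutely_integrable_1) auto
    hence "set_integrable lborel {1..} (\<lambda>t. 2 * t powr (- 1 - 2 * s))"
      unfolding set_integrable_def by (subst (asm) integrable_completion) auto
    thus ?thesis
    proof (rule set_integrable_bound)
      show "AE x in lborel. x \<in> {1..} \<longrightarrow> norm (?h x) \<le> norm (2 * x powr (- 1 - 2 * s))"
      proof (intro AE_I2 impI)
        fix x :: real assume x: "x \<in> {1..}"
        have "1 - cos x \<le> 2" using cos_ge_minus_one[of x] by linarith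
        hence "(1 - cos x) / x powr (1 + 2 * s) \<le> 2 / x powr (1 + 2 * s)"
          by (intro divide_right_mono) auto
        also have "\<dots> = 2 * x powr (- 1 - 2 * s)"
          using x powr_minus_divide[of x "1 + 2 * s"] by (simp add: algebra_simps)
        finally show "norm (?h x) \<le> norm (2 * x powr (- 1 - 2 * s))" using x by simp
      qed
    qed (auto simp: set_borel_measurable_def)
  qed
  have "set_integrable lborel ({0..1} \<union> {1..}) ?h" by (rule set_integrable_Un[OF A B]) auto
  moreover have "{0..1} \<union> {1..} = {0::real..}" by auto
  ultimately have C: "set_integrable lborel {0..} ?h" by simp
  have "integrable lborel (\<lambda>t. indicator {0..} (0 + (-1) * t) *\<^sub>R ?h (0 + (-1) * t))"
    using C unfolding set_integrable_def by (intro lborel_integrable_real_affine) auto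
  moreover have "(\<lambda>t::real. indicator {0..} (0 + (-1) * t) *\<^sub>R ?h (0 + (-1) * t)) = (\<lambda>t. indicator {..0} t *\<^sub>R ?h t)"
    by (auto simp: fun_eq_iff indicator_def)
  ultimately have "set_integrable lborel {..0} ?h" unfolding set_integrable_def by simp
  from set_integrable_Un[OF C this] have "set_integrable lborel ({0..} \<union> {..0}) ?h" by simp
  moreover have "{0..} \<union> {..0::real} = UNIV" by auto
  ultimately show ?thesis by (simp add: set_integrable_def)
qed

lemma frac_const_pos:
  assumes "0 < s" "s < 1"
  shows "frac_const s > 0"
proof -
  let ?h = "\<lambda>t::real. (1 - cos t) / \<bar>t\<bar> powr (1 + 2 * s)"
  have "(LBINT t. ?h t) \<noteq> 0"
  proof
    assume "(LBINT t. ?h t) = 0"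
    hence "AE t in lborel. ?h t = 0"
      using integral_nonneg_eq_0_iff_AE[OF frac_kernel_integrable[OF assms]] by simp
    hence "AE t::real in lborel. t \<notin> {1<..<2}"
    proof (rule AE_mp, intro AE_I2 impI notI)
      fix t :: real assume t: "?h t = 0" "t \<in> {1<..<2}"
      have "cos t < cos 0" using t pi_gt3 by (intro cos_monotone_0_pi) auto
      thus False using t by auto
    qed
    hence "emeasure lborel {1<..<2::real} = 0"
      by (subst (asm) AE_iff_measurable[OF _ refl]) (auto simp del: emeasure_lborel_Ioo simp: greaterThanLessThan_eq Collect_conj_eq greaterThan_def lessThan_def)
    thus False by simp
  qed
  moreover have "(LBINT t. ?h t) \<ge> 0" by (intro integral_nonneg_AE) auto
  ultimately have "(LBINT t. ?h t) > 0" by linarith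
  thus ?thesis by (simp add: frac_const_def)
qed

definition orthonormal_sets :: "nat \<Rightarrow> 'a::euclidean_space set set" where
  "orthonormal_sets k =
     {B. card B = k \<and> finite B \<and> pairwise orthogonal B \<and> (\<forall>\<xi>\<in>B. norm \<xi> = 1)}"

definition C2_on :: "'a::real_normed_vector set \<Rightarrow> ('a \<Rightarrow> real) \<Rightarrow> bool" where
  "C2_on S f \<longleftrightarrow>
     (\<exists>(f' :: 'a \<Rightarrow> 'a \<Rightarrow>\<^sub>L real) (f'' :: 'a \<Rightarrow> 'a \<Rightarrow>\<^sub>L 'a \<Rightarrow>\<^sub>L real).
        (\<forall>x\<in>S. (f has_derivative blinfun_apply (f' x)) (at x)) \<and>
        (\<forall>x\<in>S. (f' has_derivative blinfun_apply (f'' x)) (at x)) \<and>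
        continuous_on S f'')"

(* Near each boundary point the domain is, in suitable orthonormal coordinates, the
   region strictly above a C^2 graph.  The unit vector nu is the vertical direction and
   y - (y \<bullet> nu) nu is the horizontal part of y, so only the restriction of gamma to the
   hyperplane orthogonal to nu matters. *)
definition C2_domain :: "'a::euclidean_space set \<Rightarrow> bool" where
  "C2_domain \<Omega> \<longleftrightarrow> open \<Omega> \<and> connected \<Omega> \<and> \<Omega> \<noteq> {} \<and>
     (\<forall>x\<in>frontier \<Omega>. \<exists>r>0. \<exists>\<nu> \<gamma>. norm \<nu> = 1 \<and> C2_on UNIV \<gamma> \<and>
        \<Omega> \<inter> ball x r = {y \<in> ball x r. y \<bullet> \<nu> > \<gamma> (y - (y \<bullet> \<nu>) *\<^sub>R \<nu>)})"

definition lsc_on :: "'a::topological_space set \<Rightarrow> ('a \<Rightarrow> real) \<Rightarrow> bool" where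
  "lsc_on S u \<longleftrightarrow> (\<forall>x\<in>S. \<forall>a<u x. \<forall>\<^sub>F y in at x within S. a < u y)"

(* Lebesgue integral with values in the extended reals, meaningful as soon as the positive
   or the negative part has finite integral. *)
definition ext_integral :: "real set \<Rightarrow> (real \<Rightarrow> real) \<Rightarrow> ereal" where
  "ext_integral A f =
     enn2ereal (\<integral>\<^sup>+\<tau>\<in>A. ennreal (f \<tau>) \<partial>lebesgue) - enn2ereal (\<integral>\<^sup>+\<tau>\<in>A. ennreal (- f \<tau>) \<partial>lebesgue)"

lemma ext_integral_eq:
  assumes "set_integrable lebesgue A f"
  shows "ext_integral A f = ereal (LINT \<tau>:A|lebesgue. f \<tau>)"
proof -
  let ?g = "\<lambda>\<tau>. indicator A \<tau> *\<^sub>R f \<tau>"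
  have i: "integrable lebesgue ?g" using assms by (simp add: set_integrable_def)
  have 1: "(\<integral>\<^sup>+\<tau>\<in>A. ennreal (f \<tau>) \<partial>lebesgue) = (\<integral>\<^sup>+\<tau>. ennreal (?g \<tau>) \<partial>lebesgue)"
    and 2: "(\<integral>\<^sup>+\<tau>\<in>A. ennreal (- f \<tau>) \<partial>lebesgue) = (\<integral>\<^sup>+\<tau>. ennreal (- ?g \<tau>) \<partial>lebesgue)"
    by (auto intro!: nn_integral_cong simp: indicator_def)
  obtain p q where pq: "p \<ge> 0" "q \<ge> 0" "(\<integral>\<^sup>+\<tau>. ennreal (?g \<tau>) \<partial>lebesgue) = ennreal p"
    "(\<integral>\<^sup>+\<tau>. ennreal (- ?g \<tau>) \<partial>lebesgue) = ennreal q" "integral\<^sup>L lebesgue ?g = p - q"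
    using i by (elim integrableE) blast
  show ?thesis
    unfolding ext_integral_def set_lebesgue_integral_def 1 2 pq
    using pq by simp
qed

(* The left-hand side of the viscosity inequality: the test function phi is used at
   distance less than rho, the function u beyond.  Extended values are needed since phi is
   only C^2 in the open ball and touches u from below: it may tend to minus infinity at the
   boundary of the ball, and the inner integral may then be minus infinity (never plus
   infinity, phi being bounded above by a translate of the bounded function u). *)
definition test_operator ::
  "real \<Rightarrow> nat \<Rightarrow> ('a::euclidean_space \<Rightarrow> real) \<Rightarrow> ('a \<Rightarrow> real) \<Rightarrow> real \<Rightarrow> 'a \<Rightarrow> ereal" where
  "test_operator s k u \<phi> \<rho> x =
     ereal (frac_const s) *
     (SUP B\<in>orthonormal_sets k. \<Sum>\<xi>\<in>B.
        ext_integral {0<..<\<rho>} (\<lambda>\<tau>. second_diff \<phi> x (\<tau> *\<^sub>R \<xi>) / \<tau> powr (1 + 2 * s)) +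
        ext_integral {\<rho><..} (\<lambda>\<tau>. second_diff u x (\<tau> *\<^sub>R \<xi>) / \<tau> powr (1 + 2 * s)))"

(* Viscosity sense of "I_k^+ u \<le> 0 in Omega".  Lebesgue measurability in the whole space
   does not give measurability along lines, which is what the one-dimensional integrals
   need; it is required separately and is automatic for Borel functions u. *)
definition viscosity_supersolution ::
  "real \<Rightarrow> nat \<Rightarrow> 'a::euclidean_space set \<Rightarrow> ('a \<Rightarrow> real) \<Rightarrow> bool" where
  "viscosity_supersolution s k \<Omega> u \<longleftrightarrow>
     u \<in> borel_measurable lebesgue \<and>
     (\<forall>x\<in>\<Omega>. \<forall>\<xi>. norm \<xi> = 1 \<longrightarrow> (\<lambda>\<tau>. u (x + \<tau> *\<^sub>R \<xi>)) \<in> borel_measurable lebesgue) \<and>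
     bounded (range u) \<and>
     lsc_on \<Omega> u \<and>
     (\<forall>x\<in>\<Omega>. \<forall>\<rho>>0. \<forall>\<phi>.
        C2_on (ball x \<rho>) \<phi> \<and> (\<forall>y\<in>ball x \<rho>. u x - \<phi> x \<le> u y - \<phi> y) \<longrightarrow>
        test_operator s k u \<phi> \<rho> x \<le> 0)"

end

theory Submission
  imports Defs
begin

text \<open>
  A paraboloid touching a supersolution \<open>u\<close> from below at \<open>y\<close> is an admissible test function whose
  contribution vanishes as \<open>\<rho> \<rightarrow> 0\<close>. Hence, for each frame, the principal-value integrals of the second
  differences of \<open>u\<close> at \<open>y\<close> have nonpositive sum. Since the operator is a supremum over frames, one
  good direction in the frame suffices for a contradiction.

  If \<open>u\<close> were negative, a paraboloid at the scale \<open>d\<close> of the distance to the boundary would touch \<open>u\<close> at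
  an almost minimal point: it costs \<open>\<epsilon> d\<^sup>-\<^sup>2\<^sup>s\<close>, whereas a direction leaving \<open>\<Omega>\<close> gains a fixed
  multiple of \<open>d\<^sup>-\<^sup>2\<^sup>s\<close>. If \<open>u\<close> vanished at an interior point, the zero test function would force
  \<open>u = 0\<close> along every line through it.

  Near the boundary, \<open>u\<close> is compared with \<open>c (R - \<bar>x - p\<bar>)\<^sup>s\<close> in an interior ball of radius \<open>R\<close>
  centred at \<open>p\<close>. Along the radius this is the \<open>s\<close>-harmonic half-line profile up to bounded errors,
  and in tangential directions its second differences have bounded integrals by scaling. The positive
  lower bound of \<open>u\<close> on the concentric ball of half the radius, seen along the radial line, outweighs
  all of these when \<open>c\<close> is small.
\<close>

section \<open>One-dimensional integrals\<close>

lemma one_plus_powr_le: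
  fixes a x :: real
  assumes "0 \<le> a" "a \<le> 1" "- 1 \<le> x"
  shows "(1 + x) powr a \<le> 1 + a * x"
proof (cases "x = - 1")
  case False
  then have x: "0 < 1 + x" using assms by simp
  then have "(1 - a) * ln 1 + a * ln (1 + x) \<le> ln ((1 - a) * 1 + a * (1 + x))"
    using concave_onD[OF ln_concave, of a 1 "1 + x"] assms by simp
  also have "(1 - a) * 1 + a * (1 + x) = 1 + a * x" by (simp add: algebra_simps)
  finally have le: "a * ln (1 + x) \<le> ln (1 + a * x)" by simp
  have "a * (1 + x) \<ge> 0" using assms x by simp
  then have "1 + a * x \<ge> 1 - a" by (simp add: algebra_simps)
  moreover have "1 + a * x > 0" if "a = 1" using that x by simp
  ultimately have "1 + a * x > 0" using assms by fastforce
  then have "exp (a * ln (1 + x)) \<le> 1 + a * x" using le by (metis exp_le_cancel_iff exp_ln)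
  then show ?thesis using x by (simp add: powr_def)
qed (use assms in auto)

text \<open>\<open>(1 + x) powr a\<close> is \<open>1 + x\<close> divided by
  \<open>(1 + x) powr (1 - a)\<close>, and the divisor lies below its tangent line \<open>D\<close>
  by the upper bound with exponent \<open>1 - a\<close>. What remains is a polynomial
  inequality.\<close>

lemma one_plus_powr_ge:
  fixes a x :: real
  assumes "0 < a" "a < 1" "- 1 \<le> x"
  shows "1 + a * x - x\<^sup>2 \<le> (1 + x) powr a"
proof (cases "x = - 1")
  case False
  then have x: "0 < 1 + x" using assms by simp
  define D where "D = 1 + (1 - a) * x"
  have "(1 - a) * (1 + x) \<ge> 0" using assms x by simp
  then have D: "D \<ge> a" by (simp add: D_def algebra_simps)
  have "(1 + x) powr (1 - a) \<le> D"
    using one_plus_powr_le[of "1 - a" x] assms by (simp add: D_def)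
  then have "(1 + x) powr a * (1 + x) powr (1 - a) \<le> (1 + x) powr a * D"
    by (intro mult_left_mono) auto
  then have *: "1 + x \<le> (1 + x) powr a * D" using x by (simp flip: powr_add)
  \<comment> \<open>The product of the two linear factors exceeds \<open>1 + x\<close> by
    \<open>a * (1 - a)\<close> times the square of \<open>x\<close>; the subtracted quadratic term
    absorbs this because \<open>D \<ge> a\<close>.\<close>
  have "(1 + a * x - x\<^sup>2) * D = 1 + x - x\<^sup>2 * (D - a * (1 - a))"
    by (simp add: D_def algebra_simps power2_eq_square power3_eq_cube)
  also have "\<dots> \<le> 1 + x"
  proof -
    have "a * (1 - a) \<le> a" using assms by (simp add: algebra_simps)
    then show ?thesis using D by simp
  qed
  finally have "(1 + a * x - x\<^sup>2) * D \<le> (1 + x) powr a * D" using * by linarith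
  then show ?thesis using D assms by (simp add: mult_le_cancel_right)
qed (use assms in auto)

text \<open>A quadratic minorant on the whole line: below -1, where the power is cut off to 0, the
  quadratic is already negative.\<close>

lemma powr_Bernoulli_below_cut:
  fixes a x :: real
  assumes "0 < a" "a < 1"
  shows "1 + a * x - x\<^sup>2 \<le> max 0 (1 + x) powr a"
proof (cases "- 1 \<le> x")
  case True
  then show ?thesis using one_plus_powr_ge[OF assms True] by simp
next
  case False
  then have "(x + 1) * (x - 1) \<ge> 0" by (intro mult_nonpos_nonpos) auto
  then have "1 + a * x - x\<^sup>2 \<le> a * x" by (simp add: algebra_simps power2_eq_square)
  also have "\<dots> \<le> 0" using False assms by (simp add: mult_nonneg_nonpos)
  finally show ?thesis by (metis order_trans powr_ge_zero)
qed

text \<open>Model for a second difference that is quadratic below the scale \<open>a\<close> and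
  bounded beyond it. It converges at 0 because \<open>s < 1\<close> and at infinity because
  \<open>0 < s\<close>; the power of \<open>a\<close> is the scaling of the kernel.\<close>

lemma has_integral_min_quadratic_kernel:
  fixes a s :: real
  assumes "0 < s" "s < 1" "0 < a"
  shows "((\<lambda>\<tau>. min 1 ((\<tau> / a)\<^sup>2) / \<tau> powr (1 + 2 * s)) has_integral
           (1 / (2 - 2 * s) + 1 / (2 * s)) / a powr (2 * s)) {0..}"
proof -
  have 1: "((\<lambda>\<tau>. min 1 ((\<tau> / a)\<^sup>2) / \<tau> powr (1 + 2 * s)) has_integral
             (1 / a\<^sup>2) * (a powr (1 - 2 * s + 1) / (1 - 2 * s + 1))) {0..a}"
  proof (rule has_integral_eq[OF _ has_integral_mult_right[OF has_integral_powr_from_0]])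
    fix t assume t: "t \<in> {0..a}"
    have "t\<^sup>2 \<le> a\<^sup>2" using t by (intro power_mono) auto
    then have "min 1 ((t / a)\<^sup>2) = t\<^sup>2 / a\<^sup>2" using assms by (simp add: power_divide)
    moreover have "t\<^sup>2 / t powr (1 + 2 * s) = t powr (1 - 2 * s)"
    proof (cases "t = 0")
      case False
      then show ?thesis using t powr_diff[of t 2 "1 + 2 * s"] by simp
    qed auto
    moreover have "1 / a\<^sup>2 * (t\<^sup>2 / t powr (1 + 2 * s)) = t\<^sup>2 / a\<^sup>2 / t powr (1 + 2 * s)" by simp
    ultimately show "1 / a\<^sup>2 * t powr (1 - 2 * s) = min 1 ((t / a)\<^sup>2) / t powr (1 + 2 * s)"
      by metis
  qed (use assms in auto)
  have 2: "((\<lambda>\<tau>. min 1 ((\<tau> / a)\<^sup>2) / \<tau> powr (1 + 2 * s)) has_integral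
             - (a powr (- (1 + 2 * s) + 1)) / (- (1 + 2 * s) + 1)) {a..}"
  proof (rule has_integral_eq[OF _ has_integral_powr_to_inf])
    fix t assume t: "t \<in> {a..}"
    then have "a\<^sup>2 \<le> t\<^sup>2" using assms by (intro power_mono) auto
    then have "min 1 ((t / a)\<^sup>2) = 1" using assms by (simp add: power_divide)
    then show "t powr (- (1 + 2 * s)) = min 1 ((t / a)\<^sup>2) / t powr (1 + 2 * s)"
      using t assms by (simp add: powr_minus_divide del: minus_add_distrib)
  qed (use assms in auto)
  have "((\<lambda>\<tau>. min 1 ((\<tau> / a)\<^sup>2) / \<tau> powr (1 + 2 * s)) has_integral
          ((1 / a\<^sup>2) * (a powr (1 - 2 * s + 1) / (1 - 2 * s + 1)) +
           - (a powr (- (1 + 2 * s) + 1)) / (- (1 + 2 * s) + 1))) ({0..a} \<union> {a..})"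
    by (rule has_integral_Un[OF 1 2])
       (use assms in \<open>auto intro: negligible_subset[OF negligible_sing[of a]]\<close>)
  moreover have "{0..a} \<union> {a..} = {0..}" using assms by auto
  moreover have "(1 / a\<^sup>2) * (a powr (1 - 2 * s + 1) / (1 - 2 * s + 1)) +
      - (a powr (- (1 + 2 * s) + 1)) / (- (1 + 2 * s) + 1) =
      (1 / (2 - 2 * s) + 1 / (2 * s)) / a powr (2 * s)"
  proof -
    have "a powr (1 - 2 * s + 1) = a\<^sup>2 / a powr (2 * s)"
      using assms powr_diff[of a 2 "2 * s"] by (simp add: algebra_simps)
    moreover have "a powr (- (1 + 2 * s) + 1) = 1 / a powr (2 * s)"
      using powr_minus_divide[of a "2 * s"] by simp
    ultimately show ?thesis using assms by (simp add: field_simps)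
  qed
  ultimately show ?thesis by simp
qed

section \<open>Second differences of the half-line profile\<close>

lemma continuous_on_kernel:
  assumes "0 < a" "continuous_on {a..b} f"
  shows "continuous_on {a..b} (\<lambda>\<tau>::real. f \<tau> / \<tau> powr q :: real)"
  using assms by (intro continuous_intros) auto

text \<open>Half of the second difference of the half-line profile, on the side away from the boundary,
  is moved to the side towards the boundary by \<open>x = \<tau> / (1 + \<tau>)\<close>.\<close>
lemma integral_powr_increment_substitution:
  fixes s e T :: real
  assumes "0 < e" "e \<le> T"
  shows "integral {e..T} (\<lambda>\<tau>. ((1 + \<tau>) powr s - 1) / \<tau> powr (1 + 2 * s)) =
    integral {e / (1 + e)..T / (1 + T)}
      (\<lambda>x. (1 - (1 - x) powr s) * (1 - x) powr (s - 1) / x powr (1 + 2 * s))"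
proof -
  let ?f = "\<lambda>x::real. (1 - (1 - x) powr s) * (1 - x) powr (s - 1) / x powr (1 + 2 * s)"
  let ?g = "\<lambda>\<tau>::real. \<tau> / (1 + \<tau>)"
  have mono: "?g x \<le> ?g y" if "0 \<le> x" "x \<le> y" for x y :: real
    using that by (simp add: field_simps)
  have pos: "?g e > 0" "?g T < 1" using assms by auto
  have "((\<lambda>x. (1 / (1 + x)\<^sup>2) *\<^sub>R ?f (?g x)) has_integral (integral {?g e..?g T} ?f)) {e..T}"
  proof (rule has_integral_substitution)
    show "?g ` {e..T} \<subseteq> {?g e..?g T}" using mono assms by auto
    show "continuous_on {?g e..?g T} ?f"
      using pos by (intro continuous_intros) auto
    fix x assume "x \<in> {e..T}"
    then show "(?g has_field_derivative 1 / (1 + x)\<^sup>2) (at x within {e..T})"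
      using assms by (auto intro!: derivative_eq_intros simp: power2_eq_square)
  qed (use assms mono[of e T] in auto)
  moreover have "(1 / (1 + x)\<^sup>2) *\<^sub>R ?f (?g x) = ((1 + x) powr s - 1) / x powr (1 + 2 * s)"
    if "x \<in> {e..T}" for x
  proof -
    have x: "x > 0" using that assms by auto
    define y where "y = 1 + x"
    have y: "y > 0" "1 - ?g x = 1 / y" using x by (auto simp: y_def field_simps)
    have "?f (?g x) = (1 - 1 / y powr s) * (1 / y powr (s - 1)) / (x powr (1 + 2 * s) / y powr (1 + 2 * s))"
      unfolding y(2) using x y by (simp add: powr_divide y_def)
    also have "\<dots> = (y powr s - 1) * (y powr (1 + 2 * s) / (y powr s * y powr (s - 1))) / x powr (1 + 2 * s)"
      using x y by (simp add: field_simps)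
    \<comment> \<open>This square of \<open>1 + x\<close> cancels the Jacobian of the
      substitution.\<close>
    also have "y powr (1 + 2 * s) / (y powr s * y powr (s - 1)) = y powr 2"
      by (simp flip: powr_add powr_diff)
    finally show ?thesis using y by (simp add: y_def)
  qed
  ultimately show ?thesis using has_integral_eq by (metis (no_types, lifting) integral_unique)
qed

lemma powr_ge_linear:
  fixes s x :: real
  assumes "0 < s" "s < 1" "0 \<le> x" "x \<le> 1"
  shows "x \<le> x powr s"
proof (cases "x = 0")
  case False
  then have "x powr 1 \<le> x powr s" using assms by (intro powr_mono') auto
  then show ?thesis using assms by simp
qed auto

text \<open>The positive part of x to the power s is s-harmonic on the positive half-line: over all
  \<tau> > 0 its second differences at 1 integrate to zero. This is a quantitative lower bound for
  the truncation to \<open>{e..T}\<close>. The gain \<open>f1\<close> and the loss \<open>f2\<close>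
  are brought to a common interval by substitution, where their difference has an explicit
  antiderivative.\<close>

lemma integral_halfline_second_diff_ge:
  fixes s e T :: real
  assumes s: "0 < s" "s < 1" and e: "0 < e" "e \<le> 1 / 2" and T: "1 \<le> T"
  shows "integral {e..T} (\<lambda>\<tau>. ((1 + \<tau>) powr s + max 0 (1 - \<tau>) powr s - 2) / \<tau> powr (1 + 2 * s))
    \<ge> - (4 / s) / T powr s - e powr (2 - 2 * s) / (2 * s)"
proof -
  \<comment> \<open>The image of \<open>T\<close> under the substitution \<tau> / (1 +
    \<tau>).\<close>
  define b where "b = T / (1 + T)"
  have b: "1 / 2 \<le> b" "b < 1" "1 - b = 1 / (1 + T)" "b \<le> T"
    using T by (auto simp: b_def field_simps)
  define f1 where "f1 = (\<lambda>\<tau>::real. ((1 + \<tau>) powr s - 1) / \<tau> powr (1 + 2 * s))"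
  define f2 where "f2 = (\<lambda>\<tau>::real. (1 - max 0 (1 - \<tau>) powr s) / \<tau> powr (1 + 2 * s))"
  define h where "h = (\<lambda>x::real. (1 - (1 - x) powr s) * (1 - x) powr (s - 1) / x powr (1 + 2 * s))"
  define \<Phi> where "\<Phi> = (\<lambda>x::real. (1 - (1 - x) powr s)\<^sup>2 / (2 * s) * x powr (- 2 * s))"
  \<comment> \<open>\<open>\<Phi>\<close> is an antiderivative of \<open>h - f2\<close>, so no value of the beta function is needed.\<close>
  have f1i: "f1 integrable_on {e..T}"
    unfolding f1_def using e by (intro integrable_continuous_interval continuous_on_kernel continuous_intros) auto
  have f2i: "f2 integrable_on {c..d}" if "0 < c" for c d
    unfolding f2_def using that s
    by (intro integrable_continuous_interval continuous_on_kernel continuous_on_diff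
        continuous_on_powr' continuous_on_const continuous_on_max continuous_on_id) auto
  have hi: "h integrable_on {c..b}" if "0 < c" for c
    unfolding h_def using that b by (intro integrable_continuous_interval continuous_intros) auto
  have h0: "0 \<le> h x" if "0 < x" "x < 1" for x
    using that s unfolding h_def by (auto intro!: mult_nonneg_nonneg divide_nonneg_nonneg powr_le1)
  have e': "0 < e / (1 + e)" "e / (1 + e) \<le> e" using e by (auto simp: field_simps)
  \<comment> \<open>The substitution starts at \<open>e / (1 + e)\<close>, to the left of
    \<open>e\<close>; since \<open>h\<close> is nonnegative, cutting back to \<open>{e..b}\<close>
    only lowers the integral.\<close>
  have "integral {e..b} h \<le> integral {e / (1 + e)..b} h"
    using e e' b h0 hi[of e] hi[of "e / (1 + e)"]
    by (intro integral_subset_le) auto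
  also have "\<dots> = integral {e..T} f1"
    unfolding f1_def h_def b_def using e T by (intro integral_powr_increment_substitution[symmetric]) auto
  finally have 1: "integral {e..b} h \<le> integral {e..T} f1" .
  have "((\<lambda>x. h x - f2 x) has_integral (\<Phi> b - \<Phi> e)) {e..b}"
  proof (rule fundamental_theorem_of_calculus)
    fix x assume x: "x \<in> {e..b}"
    define y where "y = (1 - x) powr s"
    have x': "0 < x" "x < 1" using x e b by auto
    have "(\<Phi> has_real_derivative
        2 * (1 - y) * (s * (1 - x) powr (s - 1)) / (2 * s) * x powr (- 2 * s) +
        (1 - y)\<^sup>2 / (2 * s) * (- 2 * s * x powr (- 2 * s - 1))) (at x within {e..b})"
      unfolding \<Phi>_def y_def using x' s
      by (auto intro!: derivative_eq_intros simp: power2_eq_square field_simps)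
    also have "2 * (1 - y) * (s * (1 - x) powr (s - 1)) / (2 * s) * x powr (- 2 * s) +
        (1 - y)\<^sup>2 / (2 * s) * (- 2 * s * x powr (- 2 * s - 1)) = h x - f2 x"
    proof -
      have "1 + 2 * s = - (- 2 * s - 1)" by simp
      then have q: "1 / x powr (1 + 2 * s) = x powr (- 2 * s - 1)"
        by (metis powr_minus_divide inverse_eq_divide minus_minus powr_minus)
      have p: "x powr (- 2 * s) = x * x powr (- 2 * s - 1)"
        using x' powr_add[of x 1 "- 2 * s - 1"] by simp
      have yy: "y = (1 - x) * (1 - x) powr (s - 1)"
        unfolding y_def using x' powr_add[of "1 - x" 1 "s - 1"] by simp
      define z where "z = (1 - x) powr (s - 1)"
      define r where "r = x powr (- 2 * s - 1)"
      have "h x = (1 - y) * z * r"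
        unfolding h_def y_def z_def r_def by (subst q[symmetric]) simp
      moreover have "f2 x = (1 - y) * r"
        unfolding f2_def y_def r_def using x' by (subst q[symmetric]) simp
      moreover have "2 * (1 - y) * (s * z) / (2 * s) * (x * r) + (1 - y)\<^sup>2 / (2 * s) * (- 2 * s * r) =
          (1 - y) * z * (x * r) - (1 - y)\<^sup>2 * r"
        using s by simp
      \<comment> \<open>By \<open>y = (1 - x) * z\<close> one has
        \<open>z * x - (1 - y) = z - 1\<close>.\<close>
      moreover have "(1 - y) * z * (x * r) - (1 - y)\<^sup>2 * r = (1 - y) * z * r - (1 - y) * r"
        using yy[folded z_def] by algebra
      ultimately show ?thesis
        unfolding p z_def[symmetric] r_def[symmetric] by metis
    qed
    finally show "(\<Phi> has_vector_derivative h x - f2 x) (at x within {e..b})"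
      by (simp add: has_real_derivative_iff_has_vector_derivative)
  qed (use e b in auto)
  then have 2: "integral {e..b} h - integral {e..b} f2 = \<Phi> b - \<Phi> e"
    using integral_diff[OF hi[OF e(1)] f2i[OF e(1)]] by (simp add: integral_unique)
  \<comment> \<open>Beyond \<open>b\<close> the loss has no counterpart left and is bounded by the
    bare kernel; the resulting value is the leading term of \<open>\<Phi> b\<close> and will cancel
    against it.\<close>
  have "integral {b..T} f2 \<le> integral {b..} (\<lambda>x. x powr (- (1 + 2 * s)))"
  proof -
    have i: "(\<lambda>x. x powr (- (1 + 2 * s))) integrable_on {b..}"
      using has_integral_powr_to_inf[of "- (1 + 2 * s)" b] b s by (auto simp: integrable_on_def)
    have j: "(\<lambda>x. x powr (- (1 + 2 * s))) integrable_on {b..T}"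
      using b by (intro integrable_continuous_interval continuous_intros) auto
    have "integral {b..T} f2 \<le> integral {b..T} (\<lambda>x. x powr (- (1 + 2 * s)))"
    proof (rule integral_le[OF f2i j])
      fix x assume "x \<in> {b..T}"
      show "f2 x \<le> x powr - (1 + 2 * s)"
        unfolding f2_def powr_minus_divide by (intro divide_right_mono) auto
    qed (use b in auto)
    also have "\<dots> \<le> integral {b..} (\<lambda>x. x powr (- (1 + 2 * s)))"
      by (intro integral_subset_le i j) auto
    finally show ?thesis .
  qed
  also have "\<dots> = b powr (- 2 * s) / (2 * s)"
    using has_integral_powr_to_inf[of "- (1 + 2 * s)" b] b s by (simp add: integral_unique)
  finally have 3: "integral {b..T} f2 \<le> b powr (- 2 * s) / (2 * s)" .
  have 4: "integral {e..b} f2 + integral {b..T} f2 = integral {e..T} f2"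
    using e b f2i by (intro Henstock_Kurzweil_Integration.integral_combine) auto
  have "(1 - b) powr s \<le> 1 / T powr s"
    unfolding b(3) using T s by (simp add: powr_divide frac_le powr_mono2)
  moreover have "b powr (- 2 * s) \<le> 4"
  proof -
    have "b powr (- 2 * s) \<le> (1 / 2) powr (- 2 * s)" using b s by (intro powr_mono2') auto
    also have "\<dots> \<le> (1 / 2) powr (- 2)" using s by (intro powr_mono') auto
    finally show ?thesis by (simp add: powr_minus power2_eq_square)
  qed
  ultimately have 5: "(1 - b) powr s * b powr (- 2 * s) \<le> 1 / T powr s * 4"
    by (intro mult_mono) auto
  \<comment> \<open>Expanding the square in \<open>\<Phi> b\<close>, its leading term cancels; the
    only negative remainder carries the factor \<open>(1 - b) powr s\<close>, which is of order
    \<open>1 / T powr s\<close>.\<close>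
  have "\<Phi> b - b powr (- 2 * s) / (2 * s) =
      ((1 - b) powr s)\<^sup>2 * b powr (- 2 * s) / (2 * s) - (1 - b) powr s * b powr (- 2 * s) / s"
    unfolding \<Phi>_def using s by (simp add: field_simps power2_eq_square)
  also have "\<dots> \<ge> 0 - (1 / T powr s * 4) / s"
    using 5 s by (intro diff_mono divide_right_mono) auto
  finally have 6: "\<Phi> b - b powr (- 2 * s) / (2 * s) \<ge> - (4 / s) / T powr s" by (simp add: mult.commute)
  have 7: "\<Phi> e \<le> e powr (2 - 2 * s) / (2 * s)"
  proof -
    have "(1 - (1 - e) powr s)\<^sup>2 \<le> e\<^sup>2"
      using powr_ge_linear[of s "1 - e"] s e powr_le1[of s "1 - e"]
      by (intro power_mono) auto
    then have "\<Phi> e \<le> e\<^sup>2 / (2 * s) * e powr (- 2 * s)"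
      unfolding \<Phi>_def using s by (intro mult_right_mono divide_right_mono) auto
    also have "\<dots> = e powr (2 - 2 * s) / (2 * s)"
      using e powr_add[of e 2 "- 2 * s"] by simp
    finally show ?thesis .
  qed
  have "integral {e..T} (\<lambda>\<tau>. ((1 + \<tau>) powr s + max 0 (1 - \<tau>) powr s - 2) / \<tau> powr (1 + 2 * s))
      = integral {e..T} (\<lambda>\<tau>. f1 \<tau> - f2 \<tau>)"
    by (intro integral_cong) (simp add: f1_def f2_def diff_divide_distrib add_divide_distrib)
  also have "\<dots> = integral {e..T} f1 - integral {e..T} f2"
    using f1i f2i e by (intro integral_diff) auto
  finally show ?thesis using 1 2 3 4 6 7 by linarith
qed

section \<open>Quadratic test functions\<close>

lemma C2_on_paraboloid:
  fixes x p :: "'a::euclidean_space"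
  shows "C2_on S (\<lambda>z. p \<bullet> (z - x) - M * (norm (z - x))\<^sup>2)"
  unfolding C2_on_def
proof (intro exI conjI ballI)
  let ?f' = "\<lambda>z. blinfun_inner_left (p - (2 * M) *\<^sub>R (z - x))"
  let ?f'' = "\<lambda>z::'a. Blinfun (\<lambda>h. blinfun_inner_left (- (2 * M) *\<^sub>R h))"
  fix z
  show "((\<lambda>z. p \<bullet> (z - x) - M * (norm (z - x))\<^sup>2) has_derivative blinfun_apply (?f' z)) (at z)"
    unfolding power2_norm_eq_inner
    by (auto intro!: derivative_eq_intros simp: fun_eq_iff algebra_simps inner_commute)
  have bl: "bounded_linear (\<lambda>h. blinfun_inner_left (- (2 * M) *\<^sub>R h) :: 'a \<Rightarrow>\<^sub>L real)"
    by (intro bounded_linear_intros)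
  show "(?f' has_derivative blinfun_apply (?f'' z)) (at z)"
    unfolding bounded_linear_Blinfun_apply[OF bl]
    by (rule has_derivative_eq_rhs[OF bounded_linear.has_derivative[OF bounded_linear_blinfun_inner_left]])
       (auto intro!: derivative_eq_intros)
qed (rule continuous_on_const)

text \<open>Completes the vector to an orthonormal basis and keeps \<open>k - 1\<close> of the
  others; this provides a frame through any favourable direction.\<close>

lemma orthonormal_set_containing:
  fixes \<xi> :: "'a::euclidean_space"
  assumes "norm \<xi> = 1" "k \<in> {1..DIM('a)}"
  obtains B where "B \<in> orthonormal_sets k" "\<xi> \<in> B"
proof -
  obtain S :: "'a set" where S: "\<xi> \<in> S" "pairwise orthogonal S" "\<And>x. x \<in> S \<Longrightarrow> norm x = 1"
    "independent S" "card S = DIM('a)"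
    using vector_in_orthonormal_basis[OF assms(1)] by metis
  have fin: "finite S" using S(4) finiteI_independent by blast
  have "k - 1 \<le> card (S - {\<xi>})" using S assms fin by (simp add: diff_le_mono)
  then obtain A where A: "A \<subseteq> S - {\<xi>}" "card A = k - 1" "finite A"
    by (metis obtain_subset_with_card_n)
  have "insert \<xi> A \<subseteq> S" "\<xi> \<notin> A" using A S by auto
  then have "insert \<xi> A \<in> orthonormal_sets k"
    unfolding orthonormal_sets_def using A S assms pairwise_subset[OF S(2)] by auto
  then show ?thesis using that by blast
qed

section \<open>From the viscosity inequality to integrals of the supersolution\<close>

lemma has_integral_quadratic_kernel:
  fixes s \<rho> :: real
  assumes "0 < s" "s < 1" "0 < \<rho>"
  shows "((\<lambda>\<tau>. \<tau>\<^sup>2 / \<tau> powr (1 + 2 * s)) has_integral \<rho> powr (2 - 2 * s) / (2 - 2 * s)) {0<..<\<rho>}"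
proof -
  have "((\<lambda>\<tau>. \<tau> powr (1 - 2 * s)) has_integral \<rho> powr (1 - 2 * s + 1) / (1 - 2 * s + 1)) {0..\<rho>}"
    using assms by (intro has_integral_powr_from_0) auto
  then have "((\<lambda>\<tau>. \<tau>\<^sup>2 / \<tau> powr (1 + 2 * s)) has_integral \<rho> powr (2 - 2 * s) / (2 - 2 * s)) {0..\<rho>}"
  proof (rule has_integral_eq[rotated, THEN has_integral_eq_rhs])
    fix t assume t: "t \<in> {0..\<rho>}"
    show "t powr (1 - 2 * s) = t\<^sup>2 / t powr (1 + 2 * s)"
      using t powr_diff[of t 2 "1 + 2 * s"] by (cases "t = 0") auto
  qed simp
  then show ?thesis
    by (simp add: has_integral_Icc_iff_Ioo)
qed

lemma set_integrable_bounded_kernel: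
  fixes f :: "real \<Rightarrow> real"
  assumes "0 < s" "0 < \<rho>" "f \<in> borel_measurable lebesgue" "\<And>\<tau>. \<bar>f \<tau>\<bar> \<le> b"
  shows "set_integrable lebesgue {\<rho>..} (\<lambda>\<tau>. f \<tau> / \<tau> powr (1 + 2 * s))"
proof (rule measurable_bounded_by_integrable_imp_absolutely_integrable)
  have "(\<lambda>\<tau>. f \<tau> / \<tau> powr (1 + 2 * s)) \<in> borel_measurable lebesgue"
    using assms(3) by (intro borel_measurable_divide) (auto intro: measurable_completion)
  then show "(\<lambda>\<tau>. f \<tau> / \<tau> powr (1 + 2 * s)) \<in> borel_measurable (lebesgue_on {\<rho>..})"
    by (rule measurable_restrict_space1)
  have "(\<lambda>\<tau>. b * \<tau> powr (- (1 + 2 * s))) integrable_on {\<rho>..}"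
    using has_integral_powr_to_inf[of "- (1 + 2 * s)" \<rho>] assms
    by (intro integrable_on_mult_right) (auto simp: integrable_on_def)
  then show "(\<lambda>\<tau>. b * \<tau> powr (- (1 + 2 * s))) integrable_on {\<rho>..}" .
  fix x assume "x \<in> {\<rho>..}"
  show "norm (f x / x powr (1 + 2 * s)) \<le> b * x powr - (1 + 2 * s)"
    unfolding powr_minus_divide using assms(4)[of x] by (simp add: divide_right_mono)
qed simp

text \<open>For a paraboloid the inner integral is explicit, the same in every direction, and can be
  moved to the right-hand side. Boundedness and measurability along lines make the outer extended
  integrals ordinary ones, and the positive factor \<open>frac_const s\<close> drops out.\<close>

lemma viscosity_supersolutionD:
  fixes u :: "'a::euclidean_space \<Rightarrow> real"
  assumes s: "0 < s" "s < 1" and u: "viscosity_supersolution s k \<Omega> u"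
    and y: "y \<in> \<Omega>" and \<rho>: "0 < \<rho>" and B: "B \<in> orthonormal_sets k"
    and touch: "\<And>z. dist z y < \<rho> \<Longrightarrow> u z \<ge> u y + p \<bullet> (z - y) - M * (norm (z - y))\<^sup>2"
  shows "(\<Sum>\<xi>\<in>B. integral {\<rho>..} (\<lambda>\<tau>. second_diff u y (\<tau> *\<^sub>R \<xi>) / \<tau> powr (1 + 2 * s)))
           \<le> real k * (2 * M * \<rho> powr (2 - 2 * s) / (2 - 2 * s))"
    and "\<xi> \<in> B \<Longrightarrow> (\<lambda>\<tau>. second_diff u y (\<tau> *\<^sub>R \<xi>) / \<tau> powr (1 + 2 * s)) integrable_on {\<rho>..}"
proof -
  let ?\<phi> = "\<lambda>z. p \<bullet> (z - y) - M * (norm (z - y))\<^sup>2"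
  let ?D = "\<lambda>u \<xi> \<tau>. second_diff u y (\<tau> *\<^sub>R \<xi>) / \<tau> powr (1 + 2 * s)"
  have B': "finite B" "card B = k" "\<And>\<xi>. \<xi> \<in> B \<Longrightarrow> norm \<xi> = 1"
    using B by (auto simp: orthonormal_sets_def)
  obtain b where b: "\<And>x. \<bar>u x\<bar> \<le> b"
    using u by (auto simp: viscosity_supersolution_def bounded_iff)
  have int: "set_integrable lebesgue {\<rho>..} (?D u \<xi>)" if "\<xi> \<in> B" for \<xi>
  proof (rule set_integrable_bounded_kernel[OF s(1) \<rho>])
    have "(\<lambda>\<tau>. u (y + \<tau> *\<^sub>R \<xi>)) \<in> borel_measurable lebesgue"
      using u y B'(3)[OF that] by (auto simp: viscosity_supersolution_def)
    moreover have "(\<lambda>\<tau>. u (y + \<tau> *\<^sub>R (- \<xi>))) \<in> borel_measurable lebesgue"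
      using u y B'(3)[OF that] unfolding viscosity_supersolution_def by (metis norm_minus_cancel)
    ultimately show "(\<lambda>\<tau>. second_diff u y (\<tau> *\<^sub>R \<xi>)) \<in> borel_measurable lebesgue"
      unfolding second_diff_def by auto
    show "\<bar>second_diff u y (\<tau> *\<^sub>R \<xi>)\<bar> \<le> 4 * b" for \<tau>
      unfolding second_diff_def using b[of y] b[of "y + \<tau> *\<^sub>R \<xi>"] b[of "y - \<tau> *\<^sub>R \<xi>"] by linarith
  qed
  then show "\<xi> \<in> B \<Longrightarrow> ?D u \<xi> integrable_on {\<rho>..}"
    by (rule set_lebesgue_integral_eq_integral(1))
  have ext_u: "ext_integral {\<rho><..} (?D u \<xi>) = ereal (integral {\<rho>..} (?D u \<xi>))" if "\<xi> \<in> B" for \<xi>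
  proof -
    have "set_integrable lebesgue {\<rho><..} (?D u \<xi>)"
      by (rule set_integrable_subset[OF int[OF that]]) auto
    then have "ext_integral {\<rho><..} (?D u \<xi>) = ereal (integral {\<rho><..} (?D u \<xi>))"
      by (simp add: ext_integral_eq set_lebesgue_integral_eq_integral(2))
    also have "integral {\<rho><..} (?D u \<xi>) = integral {\<rho>..} (?D u \<xi>)"
      by (intro integral_subset_negligible negligible_subset[OF negligible_sing[of \<rho>]]) auto
    finally show ?thesis .
  qed
  have ext_\<phi>: "ext_integral {0<..<\<rho>} (?D ?\<phi> \<xi>) = ereal (- 2 * M * \<rho> powr (2 - 2 * s) / (2 - 2 * s))"
    if "\<xi> \<in> B" for \<xi>
  proof -
    have eq: "?D ?\<phi> \<xi> = (\<lambda>\<tau>. (- 2 * M) * (\<tau>\<^sup>2 / \<tau> powr (1 + 2 * s)))"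
      using B'(3)[OF that] by (simp add: second_diff_def fun_eq_iff)
    have I: "((\<lambda>\<tau>. \<tau>\<^sup>2 / \<tau> powr (1 + 2 * s)) has_integral \<rho> powr (2 - 2 * s) / (2 - 2 * s)) {0<..<\<rho>}"
      using has_integral_quadratic_kernel[OF s \<rho>] .
    then have "(\<lambda>\<tau>. \<tau>\<^sup>2 / \<tau> powr (1 + 2 * s)) absolutely_integrable_on {0<..<\<rho>}"
      by (intro nonnegative_absolutely_integrable_1) (auto simp: integrable_on_def)
    then have "set_integrable lebesgue {0<..<\<rho>} (?D ?\<phi> \<xi>)"
      unfolding eq by (rule set_integrable_mult_right)
    then have "ext_integral {0<..<\<rho>} (?D ?\<phi> \<xi>) = ereal (integral {0<..<\<rho>} (?D ?\<phi> \<xi>))"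
      by (simp add: ext_integral_eq set_lebesgue_integral_eq_integral(2))
    also have "integral {0<..<\<rho>} (?D ?\<phi> \<xi>) = (- 2 * M) * (\<rho> powr (2 - 2 * s) / (2 - 2 * s))"
      unfolding eq by (intro integral_unique has_integral_mult_right I)
    finally show ?thesis by simp
  qed
  have "C2_on (ball y \<rho>) ?\<phi> \<and> (\<forall>z\<in>ball y \<rho>. u y - ?\<phi> y \<le> u z - ?\<phi> z)"
    using touch by (force simp: C2_on_paraboloid dist_commute)
  then have "test_operator s k u ?\<phi> \<rho> y \<le> 0"
    using u y \<rho> unfolding viscosity_supersolution_def by blast
  then have "(SUP B\<in>orthonormal_sets k. \<Sum>\<xi>\<in>B.
      ext_integral {0<..<\<rho>} (?D ?\<phi> \<xi>) + ext_integral {\<rho><..} (?D u \<xi>)) \<le> 0"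
    using frac_const_pos[OF s] unfolding test_operator_def
    by (simp add: ereal_mult_le_0_iff)
  then have "(\<Sum>\<xi>\<in>B. ext_integral {0<..<\<rho>} (?D ?\<phi> \<xi>) + ext_integral {\<rho><..} (?D u \<xi>)) \<le> 0"
    using B by (meson SUP_upper order_trans)
  also have "(\<Sum>\<xi>\<in>B. ext_integral {0<..<\<rho>} (?D ?\<phi> \<xi>) + ext_integral {\<rho><..} (?D u \<xi>)) =
      (\<Sum>\<xi>\<in>B. ereal (- 2 * M * \<rho> powr (2 - 2 * s) / (2 - 2 * s) + integral {\<rho>..} (?D u \<xi>)))"
    by (intro sum.cong) (simp_all add: ext_u ext_\<phi>)
  finally show "(\<Sum>\<xi>\<in>B. integral {\<rho>..} (?D u \<xi>)) \<le> real k * (2 * M * \<rho> powr (2 - 2 * s) / (2 - 2 * s))"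
    using B'(1,2) by (simp add: sum.distrib sum_subtractf)
qed

text \<open>The integral of the kernel against the minimum of 1 and the square of \<tau>, over the
  half-line.\<close>

definition kernel_const :: "real \<Rightarrow> real" where
  "kernel_const s = 1 / (2 - 2 * s) + 1 / (2 * s)"

text \<open>Separates a loss at scale \<open>a\<close> from a gain \<open>m\<close> on the window
  \<open>{t1..t2}\<close>, where the decreasing kernel is at least its value at \<open>t2\<close>.
  The bound is independent of \<rho>, so it survives \<rho> \<rightarrow> 0.\<close>

lemma integral_kernel_lower_bound:
  fixes f :: "real \<Rightarrow> real"
  assumes s: "0 < s" "s < 1" and ab: "0 < a" "0 \<le> b" and m: "0 \<le> m" and t: "0 < \<rho>" "\<rho> \<le> t1" "t1 \<le> t2"
    and int: "(\<lambda>\<tau>. f \<tau> / \<tau> powr (1 + 2 * s)) integrable_on {\<rho>..}"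
    and f: "\<And>\<tau>. \<rho> \<le> \<tau> \<Longrightarrow> f \<tau> \<ge> - b * min 1 ((\<tau> / a)\<^sup>2) + m * indicator {t1..t2} \<tau>"
  shows "integral {\<rho>..} (\<lambda>\<tau>. f \<tau> / \<tau> powr (1 + 2 * s)) \<ge>
    - b * (kernel_const s / a powr (2 * s)) + m * ((t2 - t1) / t2 powr (1 + 2 * s))"
proof -
  let ?q = "1 + 2 * s"
  let ?h = "\<lambda>\<tau>. min 1 ((\<tau> / a)\<^sup>2) / \<tau> powr ?q"
  let ?g = "\<lambda>\<tau>::real. indicator {t1..t2} \<tau> / t2 powr ?q :: real"
  have h: "(?h has_integral kernel_const s / a powr (2 * s)) {0..}"
    using has_integral_min_quadratic_kernel[OF s ab(1)] by (simp add: kernel_const_def)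
  have "?h absolutely_integrable_on {0..}"
    using h by (intro nonnegative_absolutely_integrable_1) (auto simp: integrable_on_def)
  then have "?h absolutely_integrable_on {\<rho>..}"
    by (rule set_integrable_subset) (use t in auto)
  then have hi: "?h integrable_on {\<rho>..}"
    by (rule set_lebesgue_integral_eq_integral(1))
  have hle: "integral {\<rho>..} ?h \<le> kernel_const s / a powr (2 * s)"
    unfolding integral_unique[OF h, symmetric]
    using h t hi by (intro integral_subset_le) (auto simp: integrable_on_def)
  have "((\<lambda>\<tau>::real. 1 / t2 powr ?q) has_integral (t2 - t1) * (1 / t2 powr ?q)) {t1..t2}"
    using has_integral_const_real[of "1 / t2 powr ?q" t1 t2] t by simp
  then have "((\<lambda>\<tau>. if \<tau> \<in> {t1..t2} then 1 / t2 powr ?q else 0) has_integral (t2 - t1) * (1 / t2 powr ?q)) {\<rho>..}"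
    using t by (subst has_integral_restrict) auto
  then have g: "(?g has_integral (t2 - t1) / t2 powr ?q) {\<rho>..}"
    by (rule has_integral_eq[rotated, THEN has_integral_eq_rhs]) (auto simp: indicator_def)
  have "- b * (kernel_const s / a powr (2 * s)) + m * ((t2 - t1) / t2 powr ?q) \<le>
      - b * integral {\<rho>..} ?h + m * ((t2 - t1) / t2 powr ?q)"
    using mult_left_mono[OF hle ab(2)] by simp
  also have "\<dots> = integral {\<rho>..} (\<lambda>\<tau>. - b * ?h \<tau> + m * ?g \<tau>)"
    by (intro integral_unique[symmetric] has_integral_add has_integral_mult_right g integrable_integral hi)
  also have "\<dots> \<le> integral {\<rho>..} (\<lambda>\<tau>. f \<tau> / \<tau> powr ?q)"
  proof (rule integral_le[OF _ int])
    show "(\<lambda>\<tau>. - b * ?h \<tau> + m * ?g \<tau>) integrable_on {\<rho>..}"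
      using g by (intro integrable_add integrable_on_mult_right hi) (auto simp: integrable_on_def)
    fix \<tau> assume "\<tau> \<in> {\<rho>..}"
    then have \<tau>: "\<rho> \<le> \<tau>" "0 < \<tau>" using t by auto
    have "?g \<tau> \<le> indicator {t1..t2} \<tau> / \<tau> powr ?q"
      using t s \<tau> by (auto simp: indicator_def intro!: divide_left_mono powr_mono2)
    then have "- b * ?h \<tau> + m * ?g \<tau> \<le> - b * ?h \<tau> + m * (indicator {t1..t2} \<tau> / \<tau> powr ?q)"
      using m by (intro add_left_mono mult_left_mono)
    also have "\<dots> = (- b * min 1 ((\<tau> / a)\<^sup>2) + m * indicator {t1..t2} \<tau>) / \<tau> powr ?q"
      by (simp add: add_divide_distrib diff_divide_distrib)
    also have "\<dots> \<le> f \<tau> / \<tau> powr ?q"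
      using f[OF \<tau>(1)] by (intro divide_right_mono) auto
    finally show "- b * ?h \<tau> + m * ?g \<tau> \<le> f \<tau> / \<tau> powr ?q" .
  qed
  finally show ?thesis .
qed

text \<open>Common endgame of the three contradiction arguments: \<rho> tends to 0, and both the
  paraboloid's contribution and the error \<open>E\<close> disappear because
  \<open>2 - 2 * s > 0\<close>. What is left compares the gain \<open>L\<close> in one direction
  with the losses in the rest of the frame.\<close>

lemma viscosity_supersolution_limit:
  fixes u :: "'a::euclidean_space \<Rightarrow> real"
  assumes s: "0 < s" "s < 1" and u: "viscosity_supersolution s k \<Omega> u"
    and y: "y \<in> \<Omega>" and r: "0 < r" and B: "B \<in> orthonormal_sets k" "\<xi>\<^sub>0 \<in> B"
    and touch: "\<And>z. dist z y < r \<Longrightarrow> u z \<ge> u y + p \<bullet> (z - y) - M * (norm (z - y))\<^sup>2"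
    and ab: "0 < a" "0 \<le> b"
    and others: "\<And>\<xi> \<tau>. \<xi> \<in> B - {\<xi>\<^sub>0} \<Longrightarrow> 0 < \<tau> \<Longrightarrow> second_diff u y (\<tau> *\<^sub>R \<xi>) \<ge> - b * min 1 ((\<tau> / a)\<^sup>2)"
    and main: "\<And>\<rho>. 0 < \<rho> \<Longrightarrow> \<rho> \<le> r \<Longrightarrow>
      (\<lambda>\<tau>. second_diff u y (\<tau> *\<^sub>R \<xi>\<^sub>0) / \<tau> powr (1 + 2 * s)) integrable_on {\<rho>..} \<Longrightarrow>
      integral {\<rho>..} (\<lambda>\<tau>. second_diff u y (\<tau> *\<^sub>R \<xi>\<^sub>0) / \<tau> powr (1 + 2 * s)) \<ge> L - E * \<rho> powr (2 - 2 * s)"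
  shows "L \<le> real k * b * (kernel_const s / a powr (2 * s))"
proof -
  let ?K = "kernel_const s / a powr (2 * s)"
  let ?I = "\<lambda>\<rho> \<xi>. integral {\<rho>..} (\<lambda>\<tau>. second_diff u y (\<tau> *\<^sub>R \<xi>) / \<tau> powr (1 + 2 * s))"
  define F where "F = real k * (2 * M / (2 - 2 * s)) + E"
  have K: "?K \<ge> 0" using s by (simp add: kernel_const_def)
  have B': "finite B" "card B = k" using B by (auto simp: orthonormal_sets_def)
  have "L - real k * b * ?K \<le> F * \<rho> powr (2 - 2 * s)" if \<rho>: "0 < \<rho>" "\<rho> < r" for \<rho>
  proof -
    have touch': "u z \<ge> u y + p \<bullet> (z - y) - M * (norm (z - y))\<^sup>2" if "dist z y < \<rho>" for z
      using touch[of z] that \<rho> by simp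
    note D = viscosity_supersolutionD[OF s u y \<rho>(1) B(1) touch']
    have other: "?I \<rho> \<xi> \<ge> - b * ?K" if "\<xi> \<in> B - {\<xi>\<^sub>0}" for \<xi>
      using integral_kernel_lower_bound[OF s ab order_refl \<rho>(1) order_refl order_refl D(2)] that others \<rho> by simp
    \<comment> \<open>The other directions number at most \<open>k\<close>, and each loses at most
      \<open>b * ?K\<close>.\<close>
    have "- (real k * b * ?K) \<le> - (real (card (B - {\<xi>\<^sub>0})) * (b * ?K))"
    proof -
      have "real (card (B - {\<xi>\<^sub>0})) * (b * ?K) \<le> real k * (b * ?K)"
        using B B' by (intro mult_right_mono mult_nonneg_nonneg K ab) auto
      then show ?thesis by (simp add: mult.assoc)
    qed
    also have "\<dots> = (\<Sum>\<xi>\<in>B - {\<xi>\<^sub>0}. - b * ?K)" by simp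
    also have "\<dots> \<le> (\<Sum>\<xi>\<in>B - {\<xi>\<^sub>0}. ?I \<rho> \<xi>)" by (intro sum_mono other)
    finally have "L - E * \<rho> powr (2 - 2 * s) - real k * b * ?K \<le> ?I \<rho> \<xi>\<^sub>0 + (\<Sum>\<xi>\<in>B - {\<xi>\<^sub>0}. ?I \<rho> \<xi>)"
      using main[OF \<rho>(1) _ D(2)[OF _ B(2)]] \<rho> by simp
    also have "\<dots> = (\<Sum>\<xi>\<in>B. ?I \<rho> \<xi>)" using B B' by (simp add: sum.remove)
    also have "\<dots> \<le> real k * (2 * M * \<rho> powr (2 - 2 * s) / (2 - 2 * s))" by (rule D(1))
    finally show ?thesis by (simp add: F_def algebra_simps)
  qed
  then have "\<forall>\<^sub>F \<rho> in at_right 0. L - real k * b * ?K \<le> F * \<rho> powr (2 - 2 * s)"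
    using r by (auto simp: eventually_at_right_field)
  moreover have "((\<lambda>\<rho>. F * \<rho> powr (2 - 2 * s)) \<longlongrightarrow> F * 0 powr (2 - 2 * s)) (at_right 0)"
    using s by (intro tendsto_intros tendsto_powr' eventually_at_right_less) (auto simp: eventually_at_right_less less_imp_le intro: eventually_mono[OF eventually_at_right_less])
  ultimately have "L - real k * b * ?K \<le> F * 0 powr (2 - 2 * s)"
    by (intro tendsto_lowerbound) auto
  then show ?thesis by simp
qed

section \<open>Interior and exterior tangent balls\<close>

text \<open>The second derivative is bounded on the compact ball, so the first is Lipschitz along
  segments and the linearization error is quadratic, with one constant for all base points in the
  ball.\<close>

lemma C2_on_quadratic_remainder:
  fixes f :: "'a::euclidean_space \<Rightarrow> real"
  assumes "C2_on UNIV f"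
  obtains f' M where "\<And>z. (f has_derivative blinfun_apply (f' z)) (at z)" "0 < M"
    "\<And>z y. z \<in> cball x r \<Longrightarrow> y \<in> cball x r \<Longrightarrow> \<bar>f y - f z - blinfun_apply (f' z) (y - z)\<bar> \<le> M * (norm (y - z))\<^sup>2"
proof -
  obtain f' :: "'a \<Rightarrow> 'a \<Rightarrow>\<^sub>L real" and f'' :: "'a \<Rightarrow> 'a \<Rightarrow>\<^sub>L 'a \<Rightarrow>\<^sub>L real"
    where f': "\<And>z. (f has_derivative blinfun_apply (f' z)) (at z)"
      and f'': "\<And>z. (f' has_derivative blinfun_apply (f'' z)) (at z)"
      and cont: "continuous_on UNIV f''"
    using assms by (auto simp: C2_on_def)
  have "compact (f'' ` cball x r)"
    by (intro compact_continuous_image continuous_on_subset[OF cont]) auto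
  then obtain M where M: "0 < M" "\<And>z. z \<in> cball x r \<Longrightarrow> norm (f'' z) \<le> M"
    using compact_imp_bounded bounded_pos by (metis imageI)
  have "\<bar>f y - f z - f' z (y - z)\<bar> \<le> M * (norm (y - z))\<^sup>2"
    if zy: "z \<in> cball x r" "y \<in> cball x r" for z y
  proof -
    let ?S = "closed_segment z y"
    have S: "?S \<subseteq> cball x r" using zy by (simp add: closed_segment_subset)
    have lip: "norm (f' w - f' z) \<le> M * norm (y - z)" if w: "w \<in> ?S" for w
    proof -
      have "norm (f' w - f' z) \<le> M * norm (w - z)"
      proof (rule differentiable_bound[where S = ?S and f' = "\<lambda>z. blinfun_apply (f'' z)"])
        show "onorm (blinfun_apply (f'' v)) \<le> M" if "v \<in> ?S" for v
          using M(2) S that by (auto simp: norm_blinfun.rep_eq[symmetric])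
      qed (use w has_derivative_at_withinI[OF f''] in auto)
      also have "\<dots> \<le> M * norm (y - z)"
        using M(1) segment_bound[OF w] by (intro mult_left_mono) auto
      finally show ?thesis .
    qed
    have "norm (f y - f z - f' z (y - z)) \<le> norm (y - z) * (M * norm (y - z))"
    proof (rule differentiable_bound_linearization[where S = ?S])
      show "z + t *\<^sub>R (y - z) \<in> ?S" if "t \<in> {0..1}" for t
        using that by (auto simp: in_segment algebra_simps intro!: exI[of _ t])
      show "onorm (blinfun_apply (f' w) - blinfun_apply (f' z)) \<le> M * norm (y - z)" if "w \<in> ?S" for w
      proof -
        have "blinfun_apply (f' w) - blinfun_apply (f' z) = blinfun_apply (f' w - f' z)"
          by (simp add: fun_eq_iff blinfun.diff_left)
        then show ?thesis using lip[OF that] by (simp add: norm_blinfun.rep_eq)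
      qed
    qed (use has_derivative_at_withinI[OF f'] in auto)
    then show ?thesis by (simp add: power2_eq_square mult.assoc mult.commute mult.left_commute)
  qed
  then show ?thesis using that f' M(1) by blast
qed

text \<open>At a boundary point with \<open>R > 0\<close>, \<open>e\<close> is the inner unit
  normal; one vector serves both tangent balls.\<close>

definition ball_condition :: "'a::euclidean_space set \<Rightarrow> real \<Rightarrow> 'a \<Rightarrow> bool" where
  "ball_condition \<Omega> R z \<longleftrightarrow>
     (\<exists>e. norm e = 1 \<and> ball (z + R *\<^sub>R e) R \<subseteq> \<Omega> \<and> ball (z - R *\<^sub>R e) R \<subseteq> - \<Omega>)"

lemma ball_condition_antimono:
  assumes "ball_condition \<Omega> R z" "R' \<le> R"
  shows "ball_condition \<Omega> R' z"
proof -
  obtain e where e: "norm e = 1" "ball (z + R *\<^sub>R e) R \<subseteq> \<Omega>" "ball (z - R *\<^sub>R e) R \<subseteq> - \<Omega>"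
    using assms(1) by (auto simp: ball_condition_def)
  have "ball (z + R' *\<^sub>R e) R' \<subseteq> ball (z + R *\<^sub>R e) R"
    "ball (z - R' *\<^sub>R e) R' \<subseteq> ball (z - R *\<^sub>R e) R"
    using assms(2) e(1)
    by (auto simp: ball_subset_ball_iff dist_norm simp flip: scaleR_diff_left)
  then show ?thesis using e unfolding ball_condition_def by blast
qed

text \<open>The sphere passes through \<open>z\<close>, so expanding the square leaves no constant
  term. In this form membership lets a linear term dominate a quadratic Taylor error.\<close>

lemma mem_ball_shift_iff:
  fixes e :: "'a::euclidean_space"
  assumes "norm e = 1" "0 < R"
  shows "y \<in> ball (z + R *\<^sub>R e) R \<longleftrightarrow> (norm (y - z))\<^sup>2 < 2 * R * (e \<bullet> (y - z))"
proof -
  have "y \<in> ball (z + R *\<^sub>R e) R \<longleftrightarrow> norm ((y - z) - R *\<^sub>R e) < R"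
    by (simp add: dist_norm norm_minus_commute algebra_simps)
  also have "\<dots> \<longleftrightarrow> (norm ((y - z) - R *\<^sub>R e))\<^sup>2 < R\<^sup>2"
    using assms(2) by (metis less_eq_real_def norm_ge_zero power_less_imp_less_base power_strict_mono zero_less_numeral)
  also have "(norm ((y - z) - R *\<^sub>R e))\<^sup>2 = (norm (y - z))\<^sup>2 - 2 * R * (e \<bullet> (y - z)) + R\<^sup>2"
  proof -
    define h where "h = y - z"
    show ?thesis
      using assms(1) unfolding h_def[symmetric] power2_norm_eq_inner norm_eq_1
      by (simp add: inner_diff_left inner_diff_right inner_commute power2_eq_square algebra_simps)
  qed
  finally show ?thesis by auto
qed

text \<open>\<open>\<Gamma>\<close> is a local defining function, positive exactly on the domain. At
  a boundary point it vanishes and has a gradient \<open>g\<close> of norm at least 1; in a small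
  ball tangent along \<open>g\<close> or \<open>- g\<close> the linear term beats the Taylor error
  and fixes the sign of \<open>\<Gamma>\<close>.\<close>

lemma local_ball_condition:
  fixes \<Omega> :: "'a::euclidean_space set"
  assumes "open \<Omega>" and r: "r > 0" and \<nu>: "norm \<nu> = 1" and \<gamma>: "C2_on UNIV \<gamma>"
    and eq: "\<Omega> \<inter> ball x r = {y \<in> ball x r. y \<bullet> \<nu> > \<gamma> (y - (y \<bullet> \<nu>) *\<^sub>R \<nu>)}"
  shows "\<exists>R>0. \<forall>z\<in>frontier \<Omega> \<inter> ball x (r / 2). ball_condition \<Omega> R z"
proof -
  define P where "P = (\<lambda>y::'a. y - (y \<bullet> \<nu>) *\<^sub>R \<nu>)"
  have P: "bounded_linear P" unfolding P_def by (intro bounded_linear_intros)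
  have nP: "norm (P h) \<le> norm h" for h
  proof -
    have "(norm (P h))\<^sup>2 = (norm h)\<^sup>2 - (h \<bullet> \<nu>)\<^sup>2"
      using \<nu> unfolding P_def power2_norm_eq_inner norm_eq_1 unfolding power2_eq_square
      by (simp add: inner_diff_left inner_diff_right inner_commute)
    then have "(norm (P h))\<^sup>2 \<le> (norm h)\<^sup>2" by simp
    then show ?thesis by (rule power2_le_imp_le[OF _ norm_ge_zero])
  qed
  obtain \<gamma>' M where d: "\<And>z. (\<gamma> has_derivative blinfun_apply (\<gamma>' z)) (at z)" and M: "0 < M"
    and taylor: "\<And>z y. z \<in> cball (P x) r \<Longrightarrow> y \<in> cball (P x) r \<Longrightarrow>
       \<bar>\<gamma> y - \<gamma> z - blinfun_apply (\<gamma>' z) (y - z)\<bar> \<le> M * (norm (y - z))\<^sup>2"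
    using C2_on_quadratic_remainder[OF \<gamma>] by metis
  define \<Gamma> where "\<Gamma> = (\<lambda>y. y \<bullet> \<nu> - \<gamma> (P y))"
  have cont: "continuous_on UNIV \<Gamma>"
  proof -
    have "continuous_on UNIV \<gamma>" using d by (meson has_derivative_continuous continuous_at_imp_continuous_on)
    moreover have "continuous_on UNIV P" using P by (rule linear_continuous_on)
    ultimately have "continuous_on UNIV (\<lambda>y. \<gamma> (P y))"
      by (rule continuous_on_compose2) simp
    then show ?thesis unfolding \<Gamma>_def by (intro continuous_intros)
  qed
  have in_\<Omega>: "y \<in> \<Omega> \<longleftrightarrow> \<Gamma> y > 0" if "y \<in> ball x r" for y
  proof -
    have "y \<in> \<Omega> \<inter> ball x r \<longleftrightarrow> y \<in> {y \<in> ball x r. y \<bullet> \<nu> > \<gamma> (y - (y \<bullet> \<nu>) *\<^sub>R \<nu>)}"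
      by (simp only: eq)
    then show ?thesis using that by (simp add: \<Gamma>_def P_def)
  qed
  \<comment> \<open>The bound \<open>r / 4\<close> keeps both tangent balls inside
    \<open>ball x r\<close>; the bound \<open>1 / (2 * M)\<close> makes the linear term win.\<close>
  define R where "R = min (r / 4) (1 / (2 * M))"
  have R: "0 < R" "R \<le> r / 4" "R \<le> 1 / (2 * M)" using r M by (auto simp: R_def)
  have "ball_condition \<Omega> R z" if z: "z \<in> frontier \<Omega>" "z \<in> ball x (r / 2)" for z
  proof -
    have zr: "z \<in> ball x r" using z(2) r by auto
    have "z \<notin> \<Omega>" using z(1) \<open>open \<Omega>\<close> by (simp add: frontier_def interior_open)
    then have "\<Gamma> z \<le> 0" using in_\<Omega>[OF zr] by simp
    \<comment> \<open>Otherwise a whole neighbourhood of \<open>z\<close> would miss the domain,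
      although \<open>z\<close> lies in its closure.\<close>
    moreover have "\<not> \<Gamma> z < 0"
    proof
      assume "\<Gamma> z < 0"
      then have "z \<in> ball x r \<inter> \<Gamma> -` {..<0}" using zr by simp
      moreover have "open (ball x r \<inter> \<Gamma> -` {..<0})"
        using cont by (intro open_Int open_vimage) auto
      moreover have "z \<in> closure \<Omega>" using z(1) by (simp add: frontier_def)
      ultimately have "\<Omega> \<inter> (ball x r \<inter> \<Gamma> -` {..<0}) \<noteq> {}"
        by (metis Int_commute disjoint_iff open_Int_closure_eq_empty)
      then show False using in_\<Omega> by fastforce
    qed
    ultimately have \<Gamma>z: "\<Gamma> z = 0" by simp
    define L where "L = (\<lambda>h. h \<bullet> \<nu> - \<gamma>' (P z) (P h))"
    have L: "bounded_linear L"
      unfolding L_def by (intro bounded_linear_intros bounded_linear_compose[OF blinfun.bounded_linear_right P])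
    define g where "g = adjoint L 1"
    have gL: "L h = g \<bullet> h" for h
      using adjoint_works[OF bounded_linear.linear[OF L], of h 1] by (simp add: g_def inner_commute)
    \<comment> \<open>Along the vertical direction \<open>\<Gamma>\<close> grows at unit rate,
      whatever the slope of the graph; this bounds the gradient from below.\<close>
    have "P \<nu> = 0" using \<nu> by (simp add: P_def norm_eq_1)
    then have "g \<bullet> \<nu> = 1" using \<nu> by (simp flip: gL add: L_def blinfun.zero_right norm_eq_1)
    then have g1: "norm g \<ge> 1" using norm_cauchy_schwarz[of g \<nu>] \<nu> by simp
    define e where "e = (1 / norm g) *\<^sub>R g"
    have e: "norm e = 1" using g1 by (auto simp: e_def)
    have ge: "g = norm g *\<^sub>R e" using g1 by (auto simp: e_def)
    have est: "\<bar>\<Gamma> y - g \<bullet> (y - z)\<bar> \<le> M * (norm (y - z))\<^sup>2" if y: "y \<in> ball x r" for y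
    proof -
      have PP: "P v \<in> cball (P x) r" if "v \<in> ball x r" for v
        using that nP[of "x - v"] by (simp add: dist_norm linear_diff[OF bounded_linear.linear[OF P], symmetric])
      have "\<bar>\<gamma> (P y) - \<gamma> (P z) - \<gamma>' (P z) (P y - P z)\<bar> \<le> M * (norm (P y - P z))\<^sup>2"
        using taylor PP y zr by blast
      also have "\<dots> \<le> M * (norm (y - z))\<^sup>2"
        using nP[of "y - z"] M by (simp add: linear_diff[OF bounded_linear.linear[OF P], symmetric] power_mono)
      also have "\<gamma> (P y) - \<gamma> (P z) - \<gamma>' (P z) (P y - P z) = - (\<Gamma> y - g \<bullet> (y - z))"
        using \<Gamma>z unfolding gL[symmetric] L_def \<Gamma>_def
        by (simp add: linear_diff[OF bounded_linear.linear[OF P]] inner_diff_left)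
      finally show ?thesis by simp
    qed
    \<comment> \<open>Stated for a general unit vector because it is applied to both
      \<open>e\<close> and \<open>- e\<close>.\<close>
    have key: "M * (norm (y - z))\<^sup>2 < norm g * (e' \<bullet> (y - z))"
      if "norm e' = 1" "y \<in> ball (z + R *\<^sub>R e') R" for y e'
    proof -
      have sq: "(norm (y - z))\<^sup>2 < 2 * R * (e' \<bullet> (y - z))" using that R mem_ball_shift_iff by blast
      have "0 < 2 * R * (e' \<bullet> (y - z))" by (rule order.strict_trans1[OF zero_le_power2 sq])
      then have pos: "e' \<bullet> (y - z) > 0" using R(1) by (simp add: zero_less_mult_iff)
      have "M * (norm (y - z))\<^sup>2 < M * (2 * R * (e' \<bullet> (y - z)))" using sq M by simp
      also have "\<dots> = (2 * M * R) * (e' \<bullet> (y - z))" by simp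
      also have "\<dots> \<le> norm g * (e' \<bullet> (y - z))"
      proof (intro mult_right_mono)
        have "2 * M * R \<le> 1" using R(3) M by (simp add: field_simps)
        then show "2 * M * R \<le> norm g" using g1 by simp
      qed (use pos in simp)
      finally show ?thesis .
    qed
    have near: "y \<in> ball x r" if "norm e' = 1" "y \<in> ball (z + R *\<^sub>R e') R" for y e'
    proof -
      have "dist y z \<le> dist y (z + R *\<^sub>R e') + dist (z + R *\<^sub>R e') z" by (rule dist_triangle)
      also have "\<dots> < R + R" using that R by (intro add_less_le_mono) (auto simp: dist_commute dist_norm)
      finally have "dist y z < r / 2" using R by simp
      then show ?thesis using z(2) dist_triangle[of x y z] by (simp add: dist_commute)
    qed
    show ?thesis unfolding ball_condition_def
    proof (intro exI conjI subsetI)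
      fix y assume y: "y \<in> ball (z + R *\<^sub>R e) R"
      have "g \<bullet> (y - z) = norm g * (e \<bullet> (y - z))" by (subst ge) simp
      then have "\<Gamma> y > 0" using key[OF e y] est[OF near[OF e y]] by linarith
      then show "y \<in> \<Omega>" using in_\<Omega>[OF near[OF e y]] by simp
    next
      fix y assume "y \<in> ball (z - R *\<^sub>R e) R"
      then have y: "y \<in> ball (z + R *\<^sub>R (- e)) R" and e': "norm (- e) = 1" using e by auto
      have "g \<bullet> (y - z) = - (norm g * (- e \<bullet> (y - z)))" by (subst ge) simp
      then have "\<Gamma> y < 0" using key[OF e' y] est[OF near[OF e' y]] by linarith
      then show "y \<in> - \<Omega>" using in_\<Omega>[OF near[OF e' y]] by simp
    qed (rule e)
  qed
  then show ?thesis using R by blast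
qed

text \<open>The frontier is compact, so finitely many local radii suffice and their minimum works
  everywhere.\<close>

lemma C2_domain_ball_condition:
  fixes \<Omega> :: "'a::euclidean_space set"
  assumes "C2_domain \<Omega>" "bounded \<Omega>"
  obtains R where "R > 0" "\<And>z. z \<in> frontier \<Omega> \<Longrightarrow> ball_condition \<Omega> R z"
proof -
  have op: "open \<Omega>" using assms by (simp add: C2_domain_def)
  have "\<exists>r>0. \<exists>R>0. \<forall>z\<in>frontier \<Omega> \<inter> ball x r. ball_condition \<Omega> R z" if "x \<in> frontier \<Omega>" for x
  proof -
    have "\<exists>r>0. \<exists>\<nu> \<gamma>. norm \<nu> = 1 \<and> C2_on UNIV \<gamma> \<and>
        \<Omega> \<inter> ball x r = {y \<in> ball x r. y \<bullet> \<nu> > \<gamma> (y - (y \<bullet> \<nu>) *\<^sub>R \<nu>)}"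
      using assms(1) that by (simp add: C2_domain_def)
    then obtain r \<nu> \<gamma> where r: "r > 0" and "norm \<nu> = 1" "C2_on UNIV \<gamma>"
      "\<Omega> \<inter> ball x r = {y \<in> ball x r. y \<bullet> \<nu> > \<gamma> (y - (y \<bullet> \<nu>) *\<^sub>R \<nu>)}"
      by (elim exE conjE)
    then have "\<exists>R>0. \<forall>z\<in>frontier \<Omega> \<inter> ball x (r / 2). ball_condition \<Omega> R z"
      by (rule local_ball_condition[OF op])
    then show ?thesis using r half_gt_zero by blast
  qed
  then have "\<forall>x\<in>frontier \<Omega>. \<exists>q. fst q > 0 \<and> snd q > 0 \<and>
      (\<forall>z\<in>frontier \<Omega> \<inter> ball x (fst q). ball_condition \<Omega> (snd q) z)"
    by (metis fst_conv snd_conv)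
  then obtain q where q: "\<forall>x\<in>frontier \<Omega>. fst (q x) > 0 \<and> snd (q x) > 0 \<and>
      (\<forall>z\<in>frontier \<Omega> \<inter> ball x (fst (q x)). ball_condition \<Omega> (snd (q x)) z)"
    using bchoice[of "frontier \<Omega>" "\<lambda>x q. fst q > 0 \<and> snd q > 0 \<and>
      (\<forall>z\<in>frontier \<Omega> \<inter> ball x (fst q). ball_condition \<Omega> (snd q) z)"] by blast
  define r R where "r = (\<lambda>x. fst (q x))" and "R = (\<lambda>x. snd (q x))"
  have r: "r x > 0" and R: "R x > 0" if "x \<in> frontier \<Omega>" for x
    using q that by (auto simp: r_def R_def)
  have bc: "ball_condition \<Omega> (R x) z" if "x \<in> frontier \<Omega>" "z \<in> frontier \<Omega>" "z \<in> ball x (r x)" for x z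
    using q that by (auto simp: r_def R_def)
  have "compact (frontier \<Omega>)" using assms(2) by (rule compact_frontier_bounded)
  moreover have "\<And>x. x \<in> frontier \<Omega> \<Longrightarrow> open (ball x (r x))" by simp
  moreover have "frontier \<Omega> \<subseteq> (\<Union>x\<in>frontier \<Omega>. ball x (r x))" using r by fastforce
  ultimately obtain C where C: "C \<subseteq> frontier \<Omega>" "finite C" "frontier \<Omega> \<subseteq> (\<Union>x\<in>C. ball x (r x))"
    by (rule compactE_image)
  \<comment> \<open>Inserting 1 keeps the minimum meaningful when \<open>C\<close> is empty.\<close>
  define R0 where "R0 = Min (insert 1 (R ` C))"
  have "R0 > 0" using C R unfolding R0_def by (subst Min_gr_iff) auto
  moreover have "ball_condition \<Omega> R0 z" if z: "z \<in> frontier \<Omega>" for z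
  proof -
    obtain x where x: "x \<in> C" "z \<in> ball x (r x)" using C(3) z by blast
    have "R0 \<le> R x" unfolding R0_def using C x by (intro Min_le) auto
    then show ?thesis using bc[OF _ z x(2)] C(1) x(1) ball_condition_antimono by blast
  qed
  ultimately show ?thesis using that by blast
qed

section \<open>Minimum principles\<close>

text \<open>If every point \<open>x\<close> is beaten by some \<open>g x\<close>, lower
  semicontinuity gives a neighbourhood of \<open>x\<close> on which the function exceeds
  \<open>f (g x)\<close>. In a finite subcover, the \<open>g c\<close> of least value lies in one of
  these neighbourhoods, which is absurd.\<close>

lemma lsc_on_attains_min:
  assumes "lsc_on K f" "compact K" "K \<noteq> {}"
  obtains y where "y \<in> K" "\<And>z. z \<in> K \<Longrightarrow> f y \<le> f z"
proof (rule ccontr)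
  assume "\<not> thesis"
  then have "\<forall>x\<in>K. \<exists>z\<in>K. f z < f x" using that by (meson not_le)
  then obtain g where g: "\<And>x. x \<in> K \<Longrightarrow> g x \<in> K" "\<And>x. x \<in> K \<Longrightarrow> f (g x) < f x" by metis
  have "\<exists>U. open U \<and> x \<in> U \<and> (\<forall>z\<in>U \<inter> K. f (g x) < f z)" if "x \<in> K" for x
  proof -
    have "\<forall>\<^sub>F z in at x within K. f (g x) < f z" using assms(1) that g(2) by (auto simp: lsc_on_def)
    then obtain U where "open U" "x \<in> U" "\<forall>z\<in>U. z \<noteq> x \<longrightarrow> z \<in> K \<longrightarrow> f (g x) < f z"
      by (auto simp: eventually_at_topological)
    then show ?thesis using g(2)[OF that] by (intro exI[of _ U]) auto
  qed
  then obtain U where U: "\<And>x. x \<in> K \<Longrightarrow> open (U x)" "\<And>x. x \<in> K \<Longrightarrow> x \<in> U x"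
    "\<And>x z. x \<in> K \<Longrightarrow> z \<in> U x \<Longrightarrow> z \<in> K \<Longrightarrow> f (g x) < f z" by (metis IntI)
  have "K \<subseteq> (\<Union>x\<in>K. U x)" using U(2) by blast
  then obtain C where C: "C \<subseteq> K" "finite C" "K \<subseteq> (\<Union>x\<in>C. U x)"
    using compactE_image[OF assms(2), of K U] U(1) by metis
  then have "C \<noteq> {}" using assms(3) by auto
  then obtain c where c: "c \<in> C" "\<And>x. x \<in> C \<Longrightarrow> f (g c) \<le> f (g x)"
    using C(2) arg_min_if_finite[of C "\<lambda>x. f (g x)"] by (meson not_le)
  then obtain x where x: "x \<in> C" "g c \<in> U x" using C g(1) by blast
  then have "f (g x) < f (g c)" using U(3)[of x "g c"] C(1) c(1) g(1) by blast
  then show False using c(2)[OF x(1)] by simp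
qed

lemma lsc_on_subset: "lsc_on S f \<Longrightarrow> T \<subseteq> S \<Longrightarrow> lsc_on T f"
  unfolding lsc_on_def by (meson subsetD eventually_at_filter filter_leD at_le)

lemma lsc_on_add_continuous:
  fixes f g :: "'a::topological_space \<Rightarrow> real"
  assumes "lsc_on S f" "continuous_on S g"
  shows "lsc_on S (\<lambda>x. f x + g x)"
  unfolding lsc_on_def
proof (intro ballI allI impI)
  fix x a assume x: "x \<in> S" and a: "a < f x + g x"
  define \<delta> where "\<delta> = (f x + g x - a) / 2"
  have "\<delta> > 0" using a by (simp add: \<delta>_def)
  have "\<forall>\<^sub>F y in at x within S. f x - \<delta> < f y"
    using assms(1) x \<open>\<delta> > 0\<close> by (simp add: lsc_on_def)
  moreover have "\<forall>\<^sub>F y in at x within S. g x - \<delta> < g y"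
    using assms(2) x \<open>\<delta> > 0\<close> by (intro order_tendstoD(1)) (auto simp: continuous_on_def)
  ultimately show "\<forall>\<^sub>F y in at x within S. a < f y + g y"
  proof eventually_elim
    case (elim y)
    have "a = f x - \<delta> + (g x - \<delta>)" by (simp add: \<delta>_def field_simps)
    then show ?case using elim by linarith
  qed
qed

section \<open>Distance to the boundary, normals and exit rays\<close>

lemma ball_infdist_subset:
  fixes x :: "'a::euclidean_space"
  assumes "x \<in> S"
  shows "ball x (infdist x (frontier S)) \<subseteq> S"
proof (rule ccontr)
  assume "\<not> ?thesis"
  then obtain z where z: "z \<in> ball x (infdist x (frontier S))" "z \<notin> S" by blast
  define r where "r = infdist x (frontier S)"
  have z: "z \<in> ball x r" "z \<notin> S" using z by (simp_all add: r_def)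
  then have "0 < r" by (auto intro: le_less_trans[OF zero_le_dist])
  then have "x \<in> ball x r \<inter> S" "z \<in> ball x r - S" using assms z by simp_all
  then have "ball x r \<inter> S \<noteq> {}" "ball x r - S \<noteq> {}" by (metis empty_iff)+
  then have "ball x r \<inter> frontier S \<noteq> {}" by (intro connected_Int_frontier connected_ball)
  then obtain w where "w \<in> frontier S" "dist x w < r" by auto
  then show False using infdist_le[of w "frontier S" x] by (simp add: r_def)
qed

lemma dist_ge_disjoint_balls:
  fixes x y :: "'a::real_normed_vector"
  assumes "ball x r \<inter> ball y q = {}" "0 < r" "0 < q"
  shows "r + q \<le> dist x y"
proof (rule ccontr)
  assume "\<not> ?thesis"
  then have less: "dist x y < r + q" by simp
  \<comment> \<open>The point dividing the segment between the centres in the ratio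
    \<open>r : q\<close> would lie in both balls.\<close>
  define w where "w = x + (r / (r + q)) *\<^sub>R (y - x)"
  have "dist x w = r / (r + q) * dist x y"
    using assms by (simp add: w_def dist_norm norm_minus_commute)
  also have "\<dots> < r" using mult_strict_left_mono[OF less assms(2)] assms by (simp add: field_simps)
  finally have "w \<in> ball x r" by simp
  moreover have "dist y w < q"
  proof -
    have "1 - r / (r + q) = q / (r + q)" using assms by (simp add: field_simps)
    moreover have "y - w = (1 - r / (r + q)) *\<^sub>R (y - x)" by (simp add: w_def algebra_simps)
    ultimately have "dist y w = q / (r + q) * dist x y"
      using assms by (simp add: dist_norm norm_minus_commute)
    also have "\<dots> < q" using mult_strict_left_mono[OF less assms(3)] assms by (simp add: field_simps)
    finally show ?thesis .
  qed
  then have "w \<in> ball y q" by simp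
  ultimately show False using assms(1) by blast
qed

text \<open>The ball about \<open>y\<close> reaching to \<open>z\<close> lies inside, the exterior
  ball outside, so their centres are at least \<open>d + R\<close> apart. The path through
  \<open>z\<close> has exactly that length, and equality in the triangle inequality forces
  collinearity.\<close>

lemma nearest_point_inward_normal:
  fixes y :: "'a::euclidean_space"
  assumes "y \<in> \<Omega>" "z \<in> frontier \<Omega>" "infdist y (frontier \<Omega>) = dist y z" "0 < R" "0 < dist y z"
    and e: "norm e = 1" "ball (z - R *\<^sub>R e) R \<subseteq> - \<Omega>"
  shows "y = z + dist y z *\<^sub>R e"
proof -
  define d where "d = dist y z"
  have "ball y d \<subseteq> \<Omega>" using ball_infdist_subset[OF assms(1)] assms(3) by (simp add: d_def)
  then have "ball y d \<inter> ball (z - R *\<^sub>R e) R = {}" using e by blast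
  then have "dist y (z - R *\<^sub>R e) \<ge> d + R"
    using assms by (intro dist_ge_disjoint_balls) (auto simp: d_def)
  then have "norm ((y - z) + R *\<^sub>R e) \<ge> norm (y - z) + norm (R *\<^sub>R e)"
    using e assms by (simp add: dist_norm d_def algebra_simps)
  then have "norm ((y - z) + R *\<^sub>R e) = norm (y - z) + norm (R *\<^sub>R e)"
    by (intro antisym norm_triangle_ineq)
  then have "norm (y - z) *\<^sub>R (R *\<^sub>R e) = norm (R *\<^sub>R e) *\<^sub>R (y - z)"
    by (rule norm_triangle_eq[THEN iffD1])
  then have "R *\<^sub>R (d *\<^sub>R e) = R *\<^sub>R (y - z)" using e assms by (simp add: d_def dist_norm mult.commute)
  then have "d *\<^sub>R e = y - z" using assms(4) by (simp only: scaleR_cancel_left) simp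
  then show ?thesis by (simp add: d_def)
qed

text \<open>Near the boundary, walking back through the nearest boundary point enters the exterior
  tangent ball. Far from it, any step longer than the diameter leaves the domain and is still
  comparable with the distance, which is at least \<open>R\<close> there.\<close>

lemma ray_exits_domain:
  fixes \<Omega> :: "'a::euclidean_space set"
  assumes "C2_domain \<Omega>" "bounded \<Omega>"
  obtains \<alpha> where "\<alpha> \<ge> 2" "\<And>y. y \<in> \<Omega> \<Longrightarrow> \<exists>\<xi> t. norm \<xi> = 1 \<and> 2 * infdist y (frontier \<Omega>) \<le> t \<and>
    t \<le> \<alpha> * infdist y (frontier \<Omega>) \<and> (\<forall>\<tau>\<in>{t..3 / 2 * t}. y + \<tau> *\<^sub>R \<xi> \<notin> \<Omega>)"
proof -
  have op: "open \<Omega>" "\<Omega> \<noteq> {}" using assms(1) by (auto simp: C2_domain_def)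
  obtain R where R: "R > 0" "\<And>z. z \<in> frontier \<Omega> \<Longrightarrow> ball_condition \<Omega> R z"
    using C2_domain_ball_condition[OF assms] by blast
  obtain D where D: "\<And>x y. x \<in> \<Omega> \<Longrightarrow> y \<in> \<Omega> \<Longrightarrow> dist x y \<le> D"
    using assms(2) unfolding bounded_two_points by blast
  have fr: "frontier \<Omega> \<noteq> {}"
    using op assms(2) not_bounded_UNIV by (auto simp: frontier_eq_empty)
  have D0: "0 \<le> D" using D op(2) by (metis all_not_in_conv dist_self)
  define \<alpha> where "\<alpha> = 2 + (D + 1) / R"
  have "\<exists>\<xi> t. norm \<xi> = 1 \<and> 2 * infdist y (frontier \<Omega>) \<le> t \<and>
    t \<le> \<alpha> * infdist y (frontier \<Omega>) \<and> (\<forall>\<tau>\<in>{t..3 / 2 * t}. y + \<tau> *\<^sub>R \<xi> \<notin> \<Omega>)" if y: "y \<in> \<Omega>" for y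
  proof -
    define d where "d = infdist y (frontier \<Omega>)"
    obtain z where z: "z \<in> frontier \<Omega>" "d = dist y z"
      using infdist_attains_inf[OF frontier_closed fr] unfolding d_def by metis
    have d0: "d > 0" using z y op by (auto simp: frontier_def interior_open)
    obtain e where e: "norm e = 1" "ball (z - R *\<^sub>R e) R \<subseteq> - \<Omega>"
      using R(2)[OF z(1)] by (auto simp: ball_condition_def)
    show ?thesis
    proof (cases "d < R")
      case True
      have "y = z + d *\<^sub>R e"
        using nearest_point_inward_normal[OF y z(1) _ R(1) _ e] z(2) d0 d_def by simp
      \<comment> \<open>For \<tau> between \<open>2 * d\<close> and \<open>3 * d\<close> the
        distance to the centre of the exterior ball stays below \<open>R\<close>, because
        \<open>d < R\<close>.\<close>
      have "y + \<tau> *\<^sub>R (- e) \<notin> \<Omega>" if "\<tau> \<in> {2 * d..3 / 2 * (2 * d)}" for \<tau>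
      proof -
        have "y + \<tau> *\<^sub>R (- e) - (z - R *\<^sub>R e) = (d + R - \<tau>) *\<^sub>R e"
          unfolding \<open>y = z + d *\<^sub>R e\<close> by (simp add: algebra_simps)
        then have "dist (y + \<tau> *\<^sub>R (- e)) (z - R *\<^sub>R e) = \<bar>d + R - \<tau>\<bar>"
          using e by (simp add: dist_norm)
        also have "\<dots> < R" using that True d0 by auto
        finally show ?thesis using e by (auto simp: dist_commute)
      qed
      moreover have "2 * d \<le> \<alpha> * d" using d0 D0 R by (intro mult_right_mono) (auto simp: \<alpha>_def)
      ultimately show ?thesis using e(1) unfolding d_def[symmetric]
        by (intro exI[of _ "- e"] exI[of _ "2 * d"]) auto
    next
      case False
      define t where "t = 2 * d + D + 1"
      have "(D + 1) / R * d \<ge> (D + 1) / R * R" using False D0 R by (intro mult_left_mono) auto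
      then have "D + 1 \<le> (D + 1) / R * d" using R by simp
      then have "t \<le> \<alpha> * d" by (simp add: t_def \<alpha>_def distrib_right)
      moreover have "y + \<tau> *\<^sub>R e \<notin> \<Omega>" if "\<tau> \<in> {t..3 / 2 * t}" for \<tau>
        using D[OF y, of "y + \<tau> *\<^sub>R e"] that d0 D0 e(1) by (auto simp: dist_norm t_def)
      ultimately show ?thesis using e(1) D0 unfolding d_def[symmetric]
        by (intro exI[of _ e] exI[of _ t]) (auto simp: t_def)
    qed
  qed
  moreover have "\<alpha> \<ge> 2" using D0 R by (simp add: \<alpha>_def)
  ultimately show ?thesis using that by blast
qed

section \<open>Sign of a supersolution: nonnegativity, then positivity\<close>

lemma viscosity_supersolution_nonneg:
  fixes u :: "'a::euclidean_space \<Rightarrow> real"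
  assumes s: "0 < s" "s < 1" and \<Omega>: "C2_domain \<Omega>" "bounded \<Omega>" and k: "k \<in> {1..DIM('a)}"
    and u: "viscosity_supersolution s k \<Omega> u" and out: "\<forall>x\<in>- \<Omega>. u x \<ge> 0"
  shows "u x \<ge> 0"
proof (rule ccontr)
  assume neg: "\<not> u x \<ge> 0"
  have op: "open \<Omega>" using \<Omega> by (simp add: C2_domain_def)
  have lsc: "lsc_on \<Omega> u" using u by (simp add: viscosity_supersolution_def)
  obtain \<alpha> where \<alpha>: "\<alpha> \<ge> 2" and exit: "\<And>y. y \<in> \<Omega> \<Longrightarrow> \<exists>\<xi> t. norm \<xi> = 1 \<and> 2 * infdist y (frontier \<Omega>) \<le> t \<and>
    t \<le> \<alpha> * infdist y (frontier \<Omega>) \<and> (\<forall>\<tau>\<in>{t..3 / 2 * t}. y + \<tau> *\<^sub>R \<xi> \<notin> \<Omega>)"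
    using ray_exits_domain[OF \<Omega>] by blast
  define m where "m = (INF z. u z)"
  have bdd: "bdd_below (range u)"
    using u by (simp add: viscosity_supersolution_def bounded_imp_bdd_below)
  have m_le: "m \<le> u z" for z unfolding m_def using bdd by (intro cINF_lower) auto
  have m: "m < 0" using m_le[of x] neg by simp
  define q where "q = 1 + 2 * s"
  \<comment> \<open>\<open>A\<close> and \<open>C\<close> are the gain and loss constants with the
    common factor \<open>d powr (- 2 * s)\<close> removed: \<open>A\<close> comes from the window
    and \<open>t \<le> 2 * \<alpha> * d\<close>, \<open>C\<close> from \<open>k + 1\<close> losses
    at scale \<open>d / 2\<close>. Then \<epsilon> is chosen so that the gain wins for every
    \<open>d\<close>.\<close>
  define A where "A = (1 / 2) / (3 / 2) powr q / (2 * \<alpha>) powr (2 * s)"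
  define C where "C = (real k + 1) * 2 * kernel_const s * 2 powr (2 * s)"
  have A: "A > 0" using \<alpha> by (simp add: A_def)
  have C: "C \<ge> 0" using s by (simp add: C_def kernel_const_def)
  define b where "b = - m * A / (C + 1)"
  define \<epsilon> where "\<epsilon> = min (- m) b / 2"
  have \<epsilon>: "0 < \<epsilon>" "\<epsilon> < - m" "\<epsilon> * C < - m * A"
  proof -
    have b: "b > 0" unfolding b_def using m A C by (intro divide_pos_pos mult_pos_pos) auto
    then show "0 < \<epsilon>" "\<epsilon> < - m" using m by (auto simp: \<epsilon>_def min_def)
    have "\<epsilon> < b" using b by (auto simp: \<epsilon>_def min_def)
    then have "\<epsilon> * (C + 1) < - m * A" using C pos_less_divide_eq[of "C + 1" \<epsilon> "- m * A"] unfolding b_def by linarith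
    then show "\<epsilon> * C < - m * A" using \<open>0 < \<epsilon>\<close> by (simp add: algebra_simps)
  qed
  obtain x0 where x0: "u x0 < m + \<epsilon>"
    using cINF_less_iff[OF _ bdd, of "m + \<epsilon>"] \<epsilon>(1) by (auto simp: m_def)
  have "u x0 < 0" using x0 \<epsilon>(2) by simp
  then have x0\<Omega>: "x0 \<in> \<Omega>" using out by force
  define d where "d = infdist x0 (frontier \<Omega>)"
  have fr: "frontier \<Omega> \<noteq> {}"
    using x0\<Omega> op \<Omega>(2) not_bounded_UNIV by (auto simp: frontier_eq_empty)
  have d: "d > 0"
    unfolding d_def using x0\<Omega> op by (intro infdist_pos_not_in_closed fr) (auto simp: frontier_def interior_open)
  have sub: "cball x0 (d / 2) \<subseteq> \<Omega>"
    using ball_infdist_subset[OF x0\<Omega>] d by (auto simp: d_def subset_iff)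
  \<comment> \<open>Chosen so that the penalty reaches \<epsilon> on the sphere of radius
    \<open>d / 2\<close>. Outside, the penalized function then exceeds
    \<open>m + \<epsilon>\<close>, hence its value at \<open>x0\<close>, and the local minimum is
    global.\<close>
  define K where "K = 4 * \<epsilon> / d\<^sup>2"
  have K: "K > 0" "K * (d / 2)\<^sup>2 = \<epsilon>" using \<epsilon>(1) d by (auto simp: K_def power_divide)
  have "lsc_on (cball x0 (d / 2)) (\<lambda>z. u z + K * (norm (z - x0))\<^sup>2)"
    by (intro lsc_on_add_continuous lsc_on_subset[OF lsc sub] continuous_intros)
  moreover have "x0 \<in> cball x0 (d / 2)" using d by simp
  ultimately obtain y where y: "y \<in> cball x0 (d / 2)"
    and ymin: "\<And>z. z \<in> cball x0 (d / 2) \<Longrightarrow> u y + K * (norm (y - x0))\<^sup>2 \<le> u z + K * (norm (z - x0))\<^sup>2"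
    using lsc_on_attains_min[of "cball x0 (d / 2)" "\<lambda>z. u z + K * (norm (z - x0))\<^sup>2"]
    by (metis (no_types, lifting) compact_cball empty_iff)
  have y0: "u y + K * (norm (y - x0))\<^sup>2 \<le> u x0" using ymin[of x0] d by simp
  then have uy: "u y < m + \<epsilon>" using x0 K(1) by (smt (verit) mult_nonneg_nonneg zero_le_power2)
  have y\<Omega>: "y \<in> \<Omega>" using y sub by blast
  have glob: "u y + K * (norm (y - x0))\<^sup>2 \<le> u z + K * (norm (z - x0))\<^sup>2" for z
  proof (cases "z \<in> cball x0 (d / 2)")
    case False
    then have "(d / 2)\<^sup>2 \<le> (norm (z - x0))\<^sup>2"
      using d by (intro power_mono) (auto simp: dist_norm norm_minus_commute)
    then have "\<epsilon> \<le> K * (norm (z - x0))\<^sup>2" using K by (metis mult_le_cancel_left_pos)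
    then show ?thesis using y0 x0 m_le[of z] by linarith
  qed (rule ymin)
  \<comment> \<open>Completing the square about \<open>y\<close> turns the paraboloid centred at
    \<open>x0\<close> into one touching at \<open>y\<close>.\<close>
  define p where "p = (- 2 * K) *\<^sub>R (y - x0)"
  have parab: "u y + p \<bullet> (z - y) - K * (norm (z - y))\<^sup>2 \<le> u z" for z
  proof -
    define a h where "a = y - x0" and "h = z - y"
    have za: "z - x0 = h + a" by (simp add: a_def h_def)
    have "(norm (h + a))\<^sup>2 = (norm h)\<^sup>2 + 2 * (a \<bullet> h) + (norm a)\<^sup>2"
      unfolding power2_norm_eq_inner by (simp add: inner_add_left inner_add_right inner_commute)
    then have "K * (norm (h + a))\<^sup>2 = K * (norm h)\<^sup>2 + 2 * K * (a \<bullet> h) + K * (norm a)\<^sup>2"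
      by (simp add: algebra_simps)
    then show ?thesis using glob[of z] unfolding za p_def a_def[symmetric] h_def[symmetric] by simp
  qed
  have low: "second_diff u y (\<tau> *\<^sub>R \<xi>) \<ge> - (2 * \<epsilon>) * min 1 ((\<tau> / (d / 2))\<^sup>2)" if "norm \<xi> = 1" for \<tau> \<xi>
  proof -
    have "second_diff u y (\<tau> *\<^sub>R \<xi>) \<ge> - 2 * K * \<tau>\<^sup>2"
      using parab[of "y + \<tau> *\<^sub>R \<xi>"] parab[of "y - \<tau> *\<^sub>R \<xi>"] that by (simp add: second_diff_def)
    moreover have "- 2 * K * \<tau>\<^sup>2 = - (2 * \<epsilon>) * (\<tau> / (d / 2))\<^sup>2"
      by (simp add: K_def power_divide)
    moreover have "second_diff u y (\<tau> *\<^sub>R \<xi>) \<ge> - (2 * \<epsilon>)"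
      using m_le[of "y + \<tau> *\<^sub>R \<xi>"] m_le[of "y - \<tau> *\<^sub>R \<xi>"] uy by (simp add: second_diff_def)
    ultimately show ?thesis by (simp add: min_def)
  qed
  define d' where "d' = infdist y (frontier \<Omega>)"
  \<comment> \<open>Since \<open>y\<close> is within \<open>d / 2\<close> of \<open>x0\<close>,
    scales measured at \<open>y\<close> and at \<open>x0\<close> are comparable.\<close>
  have d': "d / 2 \<le> d'" "d' \<le> 2 * d"
    using infdist_triangle_abs[of x0 "frontier \<Omega>" y] y d by (auto simp: d_def d'_def)
  obtain \<xi> t where \<xi>: "norm \<xi> = 1" "2 * d' \<le> t" "t \<le> \<alpha> * d'" "\<And>\<tau>. \<tau> \<in> {t..3 / 2 * t} \<Longrightarrow> y + \<tau> *\<^sub>R \<xi> \<notin> \<Omega>"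
    using exit[OF y\<Omega>] unfolding d'_def by blast
  have t: "d \<le> t" "t \<le> 2 * \<alpha> * d"
  proof -
    show "d \<le> t" using \<xi> d' by simp
    have "\<alpha> * d' \<le> \<alpha> * (2 * d)" using d' \<alpha> by (intro mult_left_mono) auto
    then show "t \<le> 2 * \<alpha> * d" using \<xi>(3) by simp
  qed
  obtain B where B: "B \<in> orthonormal_sets k" "\<xi> \<in> B"
    using orthonormal_set_containing[OF \<xi>(1) k] by blast
  define bump where "bump = (3 / 2 * t - t) / (3 / 2 * t) powr q"
  \<comment> \<open>On the window one end lies outside the domain, where \<open>u \<ge> 0\<close>,
    the other is at least \<open>m\<close>, and \<open>u y < m + \<epsilon>\<close>: this gains
    \<open>- m\<close> over the general loss of at most \<open>2 * \<epsilon>\<close>.\<close>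
  have main: "second_diff u y (\<tau> *\<^sub>R \<xi>) \<ge> - (2 * \<epsilon>) * min 1 ((\<tau> / (d / 2))\<^sup>2) + - m * indicator {t..3 / 2 * t} \<tau>" for \<tau>
  proof (cases "\<tau> \<in> {t..3 / 2 * t}")
    case True
    then have "u (y + \<tau> *\<^sub>R \<xi>) \<ge> 0" using \<xi>(4) out by blast
    moreover have "1 \<le> (\<tau> / (d / 2))\<^sup>2"
      using True t d by (intro one_le_power) (auto simp: field_simps)
    ultimately show ?thesis
      using True m_le[of "y - \<tau> *\<^sub>R \<xi>"] uy by (simp add: second_diff_def min_def)
  qed (use low[OF \<xi>(1)] in auto)
  define \<kappa> where "\<kappa> = kernel_const s / (d / 2) powr (2 * s)"
  have "- (2 * \<epsilon>) * \<kappa> + - m * bump \<le> real k * (2 * \<epsilon>) * \<kappa>"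
    unfolding \<kappa>_def
  proof (rule viscosity_supersolution_limit[OF s u y\<Omega> _ B, where E = 0 and r = t and a = "d / 2" and b = "2 * \<epsilon>" and M = K and p = p])
    show "- (2 * \<epsilon>) * min 1 ((\<tau> / (d / 2))\<^sup>2) \<le> second_diff u y (\<tau> *\<^sub>R \<xi>')"
      if "\<xi>' \<in> B - {\<xi>}" for \<xi>' \<tau>
      using low B(1) that by (auto simp: orthonormal_sets_def)
    fix \<rho> assume \<rho>: "0 < \<rho>" "\<rho> \<le> t"
      and int: "(\<lambda>\<tau>. second_diff u y (\<tau> *\<^sub>R \<xi>) / \<tau> powr (1 + 2 * s)) integrable_on {\<rho>..}"
    have "- (2 * \<epsilon>) * \<kappa> + - m * bump \<le>
        integral {\<rho>..} (\<lambda>\<tau>. second_diff u y (\<tau> *\<^sub>R \<xi>) / \<tau> powr (1 + 2 * s))"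
      unfolding bump_def q_def \<kappa>_def using d t \<epsilon> m \<rho> main
      by (intro integral_kernel_lower_bound[OF s _ _ _ \<rho> _ int]) auto
    then show "- (2 * \<epsilon>) * (kernel_const s / (d / 2) powr (2 * s)) + - m * bump - 0 * \<rho> powr (2 - 2 * s) \<le>
        integral {\<rho>..} (\<lambda>\<tau>. second_diff u y (\<tau> *\<^sub>R \<xi>) / \<tau> powr (1 + 2 * s))"
      by (simp add: \<kappa>_def)
  qed (use t d \<epsilon> parab in auto)
  then have "- m * bump \<le> (real k + 1) * (2 * \<epsilon>) * \<kappa>" by (simp add: algebra_simps)
  also have "\<dots> = \<epsilon> * C / d powr (2 * s)"
    using d by (simp add: C_def \<kappa>_def powr_divide)
  finally have "- m * bump \<le> \<epsilon> * C / d powr (2 * s)" .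
  moreover have "A / d powr (2 * s) \<le> bump"
  proof -
    have "A / d powr (2 * s) = (1 / 2) / (3 / 2) powr q / (2 * \<alpha> * d) powr (2 * s)"
      using \<alpha> d by (simp add: A_def powr_mult)
    also have "\<dots> \<le> (1 / 2) / (3 / 2) powr q / t powr (2 * s)"
      using t d s \<alpha> by (intro divide_left_mono powr_mono2 mult_pos_pos) auto
    also have "\<dots> = bump"
    proof -
      have "(3 / 2 * t) powr q = (3 / 2) powr q * (t * t powr (2 * s))"
        using t d by (subst powr_mult) (auto simp: q_def powr_add)
      then show ?thesis using t d by (simp add: bump_def)
    qed
    finally show ?thesis .
  qed
  ultimately have "- m * (A / d powr (2 * s)) \<le> \<epsilon> * C / d powr (2 * s)"
    using m by (meson mult_left_mono neg_0_le_iff_le less_imp_le order_trans)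
  then have "- m * A \<le> \<epsilon> * C" using d by (simp add: field_simps)
  then show False using \<epsilon>(3) by simp
qed

text \<open>At a zero of a nonnegative function every second difference is nonnegative, while the
  line through \<open>x\<close> meets a ball where \<open>u\<close> exceeds \<eta>; the operator
  sees this at any distance.\<close>

lemma viscosity_supersolution_pos:
  fixes u :: "'a::euclidean_space \<Rightarrow> real"
  assumes s: "0 < s" "s < 1" and "open \<Omega>" and k: "k \<in> {1..DIM('a)}"
    and u: "viscosity_supersolution s k \<Omega> u" and nonneg: "\<And>z. u z \<ge> 0"
    and "x \<in> \<Omega>" "u x \<noteq> 0" and y: "y \<in> \<Omega>"
  shows "u y > 0"
proof (rule ccontr)
  assume "\<not> u y > 0"
  then have uy: "u y = 0" using nonneg[of y] by simp
  define \<eta> where "\<eta> = u x / 2"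
  have \<eta>: "\<eta> > 0" "\<eta> < u x" using assms(8) nonneg[of x] by (auto simp: \<eta>_def)
  have "lsc_on \<Omega> u" using u by (simp add: viscosity_supersolution_def)
  then have "\<forall>\<^sub>F z in at x within \<Omega>. \<eta> < u z"
    using \<open>x \<in> \<Omega>\<close> \<eta>(2) unfolding lsc_on_def by blast
  then have "\<forall>\<^sub>F z in at x. \<eta> < u z"
    unfolding at_within_open[OF \<open>x \<in> \<Omega>\<close> \<open>open \<Omega>\<close>] .
  then obtain q where q: "q > 0" "\<And>z. z \<noteq> x \<Longrightarrow> dist z x < q \<Longrightarrow> \<eta> < u z"
    by (auto simp: eventually_at)
  have near: "\<eta> < u z" if "dist z x < q" for z using q(2)[OF _ that] \<eta>(2) by (cases "z = x") auto
  define T where "T = dist x y"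
  have T: "T > 0" using uy assms(8) by (auto simp: T_def)
  define \<xi> where "\<xi> = (1 / T) *\<^sub>R (x - y)"
  have \<xi>: "norm \<xi> = 1" "x = y + T *\<^sub>R \<xi>" using T by (auto simp: \<xi>_def T_def dist_norm)
  obtain B where B: "B \<in> orthonormal_sets k" "\<xi> \<in> B"
    using orthonormal_set_containing[OF \<xi>(1) k] by blast
  have nn: "second_diff u y h \<ge> 0" for h
    using nonneg[of "y + h"] nonneg[of "y - h"] uy by (simp add: second_diff_def)
  have main: "second_diff u y (\<tau> *\<^sub>R \<xi>) \<ge> - 0 * min 1 ((\<tau> / 1)\<^sup>2) + \<eta> * indicator {T..T + q / 2} \<tau>" for \<tau>
  proof (cases "\<tau> \<in> {T..T + q / 2}")
    case True
    have "y + \<tau> *\<^sub>R \<xi> - x = (\<tau> - T) *\<^sub>R \<xi>" unfolding \<xi>(2) by (simp add: algebra_simps)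
    then have "dist (y + \<tau> *\<^sub>R \<xi>) x < q" using True q(1) \<xi>(1) by (simp add: dist_norm)
    then show ?thesis using near nonneg[of "y - \<tau> *\<^sub>R \<xi>"] uy True
      by (simp add: second_diff_def add_increasing2 less_imp_le)
  qed (use nn in auto)
  let ?L = "\<eta> * ((T + q / 2 - T) / (T + q / 2) powr (1 + 2 * s))"
  have "?L \<le> real k * 0 * (kernel_const s / 1 powr (2 * s))"
  \<comment> \<open>The zero function touches \<open>u\<close> from below at \<open>y\<close>, so
    there is neither a loss nor an error term.\<close>
  proof (rule viscosity_supersolution_limit[OF s u y T B, where p = 0 and M = 0 and E = 0])
    fix \<rho> assume \<rho>: "0 < \<rho>" "\<rho> \<le> T"
      and int: "(\<lambda>\<tau>. second_diff u y (\<tau> *\<^sub>R \<xi>) / \<tau> powr (1 + 2 * s)) integrable_on {\<rho>..}"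
    have "- 0 * (kernel_const s / 1 powr (2 * s)) + ?L \<le>
        integral {\<rho>..} (\<lambda>\<tau>. second_diff u y (\<tau> *\<^sub>R \<xi>) / \<tau> powr (1 + 2 * s))"
      using q \<eta> main by (intro integral_kernel_lower_bound[OF s _ _ _ \<rho> _ int]) auto
    then show "?L - 0 * \<rho> powr (2 - 2 * s) \<le>
        integral {\<rho>..} (\<lambda>\<tau>. second_diff u y (\<tau> *\<^sub>R \<xi>) / \<tau> powr (1 + 2 * s))" by simp
  qed (use nonneg uy nn in auto)
  moreover have "?L > 0" using \<eta> q T by (intro mult_pos_pos divide_pos_pos) auto
  ultimately show False by simp
qed

section \<open>Barrier in a ball\<close>

text \<open>Inside the ball this is the distance to the sphere to the power s, extended by zero.
  Using the plain distance makes the profile along a radius an exact half-line power up to the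
  centre.\<close>

definition cone_barrier :: "'a::euclidean_space \<Rightarrow> real \<Rightarrow> real \<Rightarrow> 'a \<Rightarrow> real" where
  "cone_barrier p R s z = max 0 (R - dist z p) powr s"

text \<open>By AM-GM, \<open>\<bar>z - p\<bar> \<le> (r\<^sup>2 + \<bar>z - p\<bar>\<^sup>2) / (2 r)\<close>, which is quadratic in \<open>z\<close>.\<close>
lemma cone_barrier_ge:
  fixes e :: "'a::euclidean_space"
  assumes e: "norm e = 1" and r: "0 < r" "r < R" and s: "0 < s"
  defines "d \<equiv> R - r"
  shows "cone_barrier p R s (p + r *\<^sub>R e + h) \<ge>
    d powr s * max 0 (1 + (- (e \<bullet> h) / d - (norm h)\<^sup>2 / (2 * r * d))) powr s"
proof -
  have d: "d > 0" using r by (simp add: d_def)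
  define N where "N = norm (r *\<^sub>R e + h)"
  have "N\<^sup>2 = r\<^sup>2 + 2 * r * (e \<bullet> h) + (norm h)\<^sup>2"
    using e unfolding N_def power2_norm_eq_inner norm_eq_1 unfolding power2_eq_square
    by (simp add: inner_add_left inner_add_right inner_commute)
  moreover have "0 \<le> (N - r)\<^sup>2" by simp
  ultimately have "2 * r * N \<le> 2 * r\<^sup>2 + 2 * r * (e \<bullet> h) + (norm h)\<^sup>2"
    by (simp add: power2_diff ac_simps)
  then have "N \<le> r + e \<bullet> h + (norm h)\<^sup>2 / (2 * r)" using r by (simp add: field_simps power2_eq_square)
  moreover have "d * (1 + (- (e \<bullet> h) / d - (norm h)\<^sup>2 / (2 * r * d))) = d - e \<bullet> h - (norm h)\<^sup>2 / (2 * r)"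
    using d r by (simp add: field_simps)
  ultimately have "d * (1 + (- (e \<bullet> h) / d - (norm h)\<^sup>2 / (2 * r * d))) \<le> R - N"
    by (simp add: d_def)
  then have "max 0 (d * (1 + (- (e \<bullet> h) / d - (norm h)\<^sup>2 / (2 * r * d)))) \<le> max 0 (R - N)" by simp
  then have "max 0 (d * (1 + (- (e \<bullet> h) / d - (norm h)\<^sup>2 / (2 * r * d)))) powr s \<le> max 0 (R - N) powr s"
    using s by (intro powr_mono2) auto
  also have "max 0 (R - N) powr s = cone_barrier p R s (p + r *\<^sub>R e + h)"
    by (simp add: cone_barrier_def N_def dist_norm add.assoc)
  also have "max 0 (d * (1 + (- (e \<bullet> h) / d - (norm h)\<^sup>2 / (2 * r * d)))) powr s =
      (d * max 0 (1 + (- (e \<bullet> h) / d - (norm h)\<^sup>2 / (2 * r * d)))) powr s"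
    using d by (simp add: max_mult_distrib_left)
  finally show ?thesis using d by (simp add: powr_mult)
qed

section \<open>Touching paraboloid and second differences of the barrier\<close>

lemma cone_barrier_center: "norm e = 1 \<Longrightarrow> 0 \<le> r \<Longrightarrow> r \<le> R \<Longrightarrow> cone_barrier p R s (p + r *\<^sub>R e) = (R - r) powr s"
  by (simp add: cone_barrier_def dist_norm)

text \<open>Inserts the quadratic increment of the distance bound into the Bernoulli minorant. The
  barrier can thus be replaced by a paraboloid touching it from below, for which the viscosity
  inequality is available.\<close>

lemma cone_barrier_parabola_below:
  fixes e :: "'a::euclidean_space"
  assumes e: "norm e = 1" and r: "0 < r" "r < R" and s: "0 < s" "s < 1"
  obtains q M where "0 \<le> M" "\<And>h. norm h \<le> 1 \<Longrightarrow> cone_barrier p R s (p + r *\<^sub>R e + h) \<ge>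
    cone_barrier p R s (p + r *\<^sub>R e) + q \<bullet> h - M * (norm h)\<^sup>2"
proof -
  define d where "d = R - r"
  have d: "d > 0" using r by (simp add: d_def)
  define C where "C = 1 / d + 1 / (2 * r * d)"
  \<comment> \<open>The first summand is the quadratic part of \<open>s * x\<close>, the second
    bounds the square of \<open>x\<close>.\<close>
  define M where "M = d powr s * (s / (2 * r * d) + C\<^sup>2)"
  have C: "C > 0" using d r by (simp add: C_def add_pos_pos)
  have M: "M \<ge> 0" using s r d by (simp add: M_def)
  have "cone_barrier p R s (p + r *\<^sub>R e + h) \<ge>
    cone_barrier p R s (p + r *\<^sub>R e) + (- (d powr s * s / d) *\<^sub>R e) \<bullet> h - M * (norm h)\<^sup>2" if h: "norm h \<le> 1" for h
  proof -
    define x where "x = - (e \<bullet> h) / d - (norm h)\<^sup>2 / (2 * r * d)"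
    have "\<bar>e \<bullet> h\<bar> \<le> norm h" using Cauchy_Schwarz_ineq2[of e h] e by simp
    then have 1: "\<bar>e \<bullet> h\<bar> / d \<le> norm h / d" using d by (intro divide_right_mono) auto
    have "(norm h)\<^sup>2 \<le> norm h" using h by (simp add: power2_eq_square mult_left_le_one_le)
    then have 2: "(norm h)\<^sup>2 / (2 * r * d) \<le> norm h / (2 * r * d)" using d r by (intro divide_right_mono) auto
    have "\<bar>x\<bar> \<le> \<bar>e \<bullet> h\<bar> / d + (norm h)\<^sup>2 / (2 * r * d)"
      unfolding x_def using d r abs_triangle_ineq4[of "- (e \<bullet> h) / d" "(norm h)\<^sup>2 / (2 * r * d)"] by simp
    also have "\<dots> \<le> C * norm h" using 1 2 by (simp add: C_def algebra_simps)
    finally have "\<bar>x\<bar>\<^sup>2 \<le> (C * norm h)\<^sup>2" by (intro power_mono) auto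
    then have "x\<^sup>2 \<le> C\<^sup>2 * (norm h)\<^sup>2" by (simp add: power_mult_distrib)
    then have "d powr s * (1 + s * x - C\<^sup>2 * (norm h)\<^sup>2) \<le> d powr s * (1 + s * x - x\<^sup>2)"
      by (intro mult_left_mono) auto
    also have "\<dots> \<le> d powr s * max 0 (1 + x) powr s"
      using powr_Bernoulli_below_cut[OF s] by (intro mult_left_mono) auto
    also have "\<dots> \<le> cone_barrier p R s (p + r *\<^sub>R e + h)"
      using cone_barrier_ge[OF e r s(1), where p = p and h = h] by (simp add: x_def d_def)
    also have "d powr s * (1 + s * x - C\<^sup>2 * (norm h)\<^sup>2) =
        cone_barrier p R s (p + r *\<^sub>R e) + (- (d powr s * s / d) *\<^sub>R e) \<bullet> h - M * (norm h)\<^sup>2"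
      using r e by (simp add: cone_barrier_center M_def x_def d_def[symmetric] algebra_simps)
    finally show ?thesis .
  qed
  then show ?thesis using that M by blast
qed

text \<open>Orthogonality removes the first-order term, so the barrier drops only at the scale
  \<open>sqrt (2 * r * (R - r))\<close>. Integrating gives a constant over
  \<open>(2 * r) powr s\<close>: the powers of \<open>R - r\<close> cancel.\<close>

lemma second_diff_cone_barrier_tangential:
  fixes e :: "'a::euclidean_space"
  assumes e: "norm e = 1" and r: "0 < r" "r < R" and s: "0 < s" "s < 1"
    and \<xi>: "norm \<xi> = 1" "orthogonal e \<xi>"
  shows "second_diff (cone_barrier p R s) (p + r *\<^sub>R e) (\<tau> *\<^sub>R \<xi>) \<ge>
    - (2 * (R - r) powr s) * min 1 ((\<tau> / sqrt (2 * r * (R - r)))\<^sup>2)"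
proof -
  define d where "d = R - r"
  have d: "d > 0" using r by (simp add: d_def)
  define x where "x = \<tau>\<^sup>2 / (2 * r * d)"
  have x: "x \<ge> 0" using d r by (simp add: x_def)
  have "d powr s * max 0 (1 - x) \<le> d powr s * max 0 (1 - x) powr s"
    using s x by (intro mult_left_mono powr_ge_linear) auto
  then have "d powr s * max 0 (1 - x) \<le> cone_barrier p R s (p + r *\<^sub>R e + \<tau> *\<^sub>R \<xi>)"
    "d powr s * max 0 (1 - x) \<le> cone_barrier p R s (p + r *\<^sub>R e - \<tau> *\<^sub>R \<xi>)"
    using cone_barrier_ge[OF e r s(1), where p = p and h = "\<tau> *\<^sub>R \<xi>"]
      cone_barrier_ge[OF e r s(1), where p = p and h = "- (\<tau> *\<^sub>R \<xi>)"] \<xi>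
    by (simp_all add: orthogonal_def d_def x_def)
  then have "second_diff (cone_barrier p R s) (p + r *\<^sub>R e) (\<tau> *\<^sub>R \<xi>) \<ge> 2 * (d powr s * max 0 (1 - x)) - 2 * d powr s"
    using cone_barrier_center[OF e, of r R p s] r by (simp add: second_diff_def d_def)
  also have "2 * (d powr s * max 0 (1 - x)) - 2 * d powr s = - (2 * d powr s) * min 1 x"
    by (auto simp: max_def min_def algebra_simps)
  also have "x = (\<tau> / sqrt (2 * r * d))\<^sup>2" using d r by (simp add: x_def power_divide)
  finally show ?thesis by (simp add: d_def)
qed

lemma second_diff_cone_barrier_radial:
  fixes e :: "'a::euclidean_space"
  assumes e: "norm e = 1" and r: "0 < r" "r < R" and \<tau>: "0 \<le> \<tau>" "\<tau> \<le> r"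
  shows "second_diff (cone_barrier p R s) (p + r *\<^sub>R e) (\<tau> *\<^sub>R e) =
    (R - r) powr s * ((1 + \<tau> / (R - r)) powr s + max 0 (1 - \<tau> / (R - r)) powr s - 2)"
proof -
  define d where "d = R - r"
  have d: "d > 0" using r by (simp add: d_def)
  have "p + r *\<^sub>R e + \<tau> *\<^sub>R e - p = (r + \<tau>) *\<^sub>R e" "p + r *\<^sub>R e - \<tau> *\<^sub>R e - p = (r - \<tau>) *\<^sub>R e"
    by (simp_all add: algebra_simps)
  then have n: "dist (p + r *\<^sub>R e + \<tau> *\<^sub>R e) p = r + \<tau>" "dist (p + r *\<^sub>R e - \<tau> *\<^sub>R e) p = r - \<tau>"
    using \<tau> r e by (simp_all add: dist_norm)
  have m: "max 0 (R - (r + \<tau>)) = d * max 0 (1 - \<tau> / d)" "max 0 (R - (r - \<tau>)) = d * (1 + \<tau> / d)"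
  proof -
    have "d * (1 - \<tau> / d) = d - \<tau>" "d * (1 + \<tau> / d) = d + \<tau>"
      using d by (simp_all add: right_diff_distrib distrib_left)
    then show "max 0 (R - (r + \<tau>)) = d * max 0 (1 - \<tau> / d)" "max 0 (R - (r - \<tau>)) = d * (1 + \<tau> / d)"
      using d \<tau> by (auto simp: max_mult_distrib_left) (auto simp: d_def)
  qed
  have "(d * (1 + \<tau> / d)) powr s = d powr s * (1 + \<tau> / d) powr s"
    "(d * max 0 (1 - \<tau> / d)) powr s = d powr s * max 0 (1 - \<tau> / d) powr s"
    using d \<tau> by (intro powr_mult; simp)+
  then show ?thesis
    unfolding second_diff_def cone_barrier_center[OF e less_imp_le[OF r(1)] less_imp_le[OF r(2)]]
    unfolding cone_barrier_def n m d_def[symmetric] by (simp add: algebra_simps)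
qed

text \<open>Up to \<tau> = \<open>r\<close> this is the half-line profile at scale \<open>d\<close>;
  beyond, where the line has passed the centre, it is the worst case of a nonnegative function with
  value \<open>d powr s\<close> at the base point. Apart from the term vanishing with \<rho>, the
  bound stays finite as \<open>d\<close> tends to 0.\<close>

lemma integral_radial_profile:
  fixes s d r \<rho> :: real
  assumes s: "0 < s" "s < 1" and d: "0 < d" "d \<le> r" and \<rho>: "0 < \<rho>" "\<rho> \<le> d / 2"
  defines "h \<equiv> \<lambda>\<tau>. if \<tau> \<le> r then d powr s * ((1 + \<tau> / d) powr s + max 0 (1 - \<tau> / d) powr s - 2) else - 2 * d powr s"
  shows "(\<lambda>\<tau>. h \<tau> / \<tau> powr (1 + 2 * s)) integrable_on {\<rho>..}"
    and "integral {\<rho>..} (\<lambda>\<tau>. h \<tau> / \<tau> powr (1 + 2 * s)) \<ge> - (5 / s) / r powr s - 1 / (2 * s * d powr (2 - s)) * \<rho> powr (2 - 2 * s)"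
proof -
  let ?q = "1 + 2 * s"
  define F where "F = (\<lambda>\<sigma>::real. ((1 + \<sigma>) powr s + max 0 (1 - \<sigma>) powr s - 2) / \<sigma> powr ?q)"
  have r: "r > 0" "\<rho> \<le> r" using d \<rho> by auto
  have "((\<lambda>\<tau>. (1 / d) *\<^sub>R F (\<tau> / d)) has_integral (integral {\<rho> / d..r / d} F)) {\<rho>..r}"
  proof (rule has_integral_substitution)
    show "continuous_on {\<rho> / d..r / d} F"
      unfolding F_def using s d \<rho>
      by (intro continuous_on_kernel continuous_on_diff continuous_on_add
        continuous_on_powr' continuous_on_const continuous_on_max continuous_on_id)
        (auto intro: less_le_trans[OF divide_pos_pos[OF \<rho>(1) d(1)]] add_nonneg_nonneg order_trans[OF less_imp_le[OF divide_pos_pos[OF \<rho>(1) d(1)]]])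
    show "((\<lambda>\<tau>. \<tau> / d) has_real_derivative 1 / d) (at x within {\<rho>..r})" for x
      using d by (auto intro!: derivative_eq_intros)
  qed (use d \<rho> r in \<open>auto simp: divide_right_mono\<close>)
  then have "((\<lambda>\<tau>. 1 / d powr s * ((1 / d) *\<^sub>R F (\<tau> / d))) has_integral 1 / d powr s * (integral {\<rho> / d..r / d} F)) {\<rho>..r}"
    by (rule has_integral_mult_right)
  then have 1: "((\<lambda>\<tau>. h \<tau> / \<tau> powr ?q) has_integral 1 / d powr s * (integral {\<rho> / d..r / d} F)) {\<rho>..r}"
  proof (rule has_integral_eq[rotated])
    fix \<tau> assume \<tau>: "\<tau> \<in> {\<rho>..r}"
    have "F (\<tau> / d) = ((1 + \<tau> / d) powr s + max 0 (1 - \<tau> / d) powr s - 2) * (d * (d powr s * d powr s)) / \<tau> powr ?q"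
      using \<tau> d \<rho> powr_add[of d s s] by (simp add: F_def powr_divide powr_add)
    then show "1 / d powr s * ((1 / d) *\<^sub>R F (\<tau> / d)) = h \<tau> / \<tau> powr ?q"
      using \<tau> d by (simp add: h_def)
  qed
  have "((\<lambda>\<tau>. - 2 * d powr s * \<tau> powr (- ?q)) has_integral - 2 * d powr s * (- (r powr (- ?q + 1)) / (- ?q + 1))) {r..}"
    using s r by (intro has_integral_mult_right has_integral_powr_to_inf) auto
  then have "((\<lambda>\<tau>. - 2 * d powr s * \<tau> powr (- ?q)) has_integral - 2 * d powr s * (- (r powr (- ?q + 1)) / (- ?q + 1))) {r<..}"
    by (rule has_integral_spike_set_eq[THEN iffD1, rotated 2])
      (auto intro: negligible_subset[OF negligible_sing[of r]])
  then have 2: "((\<lambda>\<tau>. h \<tau> / \<tau> powr ?q) has_integral - 2 * d powr s * (- (r powr (- ?q + 1)) / (- ?q + 1))) {r<..}"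
    by (rule has_integral_eq[rotated]) (auto simp: h_def powr_minus_divide simp del: minus_add_distrib)
  have "((\<lambda>\<tau>. h \<tau> / \<tau> powr ?q) has_integral (1 / d powr s * (integral {\<rho> / d..r / d} F) +
      - 2 * d powr s * (- (r powr (- ?q + 1)) / (- ?q + 1)))) ({\<rho>..r} \<union> {r<..})"
    by (rule has_integral_Un[OF 1 2]) (auto intro: negligible_subset[OF negligible_empty])
  moreover have "{\<rho>..r} \<union> {r<..} = {\<rho>..}" using r by auto
  ultimately have I: "((\<lambda>\<tau>. h \<tau> / \<tau> powr ?q) has_integral (1 / d powr s * (integral {\<rho> / d..r / d} F) +
      - 2 * d powr s * (- (r powr (- ?q + 1)) / (- ?q + 1)))) {\<rho>..}" by simp
  then show "(\<lambda>\<tau>. h \<tau> / \<tau> powr ?q) integrable_on {\<rho>..}" by (auto simp: integrable_on_def)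
  \<comment> \<open>After rescaling by \<open>d\<close> the cut-offs are \<open>\<rho> / d\<close>
    and \<open>r / d\<close>; multiplying by \<open>1 / d powr s\<close> turns the error at
    \<open>r / d\<close> into one in \<open>r\<close> alone.\<close>
  have "integral {\<rho> / d..r / d} F \<ge> - (4 / s) / (r / d) powr s - (\<rho> / d) powr (2 - 2 * s) / (2 * s)"
    unfolding F_def using s d \<rho> by (intro integral_halfline_second_diff_ge) (auto simp: field_simps)
  then have A1: "1 / d powr s * integral {\<rho> / d..r / d} F \<ge>
      1 / d powr s * (- (4 / s) / (r / d) powr s - (\<rho> / d) powr (2 - 2 * s) / (2 * s))"
    by (intro mult_left_mono) auto
  have A2: "1 / d powr s * (- (4 / s) / (r / d) powr s - (\<rho> / d) powr (2 - 2 * s) / (2 * s)) =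
      - (4 / s) / r powr s - 1 / (2 * s * d powr (2 - s)) * \<rho> powr (2 - 2 * s)"
  proof -
    have "d powr (2 - s) = d powr s * d powr (2 - 2 * s)" by (simp flip: powr_add)
    then show ?thesis using d r \<rho> s by (simp add: powr_divide right_diff_distrib)
  qed
  have A3: "- 2 * d powr s * (- (r powr (- ?q + 1)) / (- ?q + 1)) \<ge> - (1 / s) / r powr s"
  proof -
    have "d powr s \<le> r powr s" using d s by (intro powr_mono2) auto
    then have "d powr s / (r powr s * r powr s) / s \<le> r powr s / (r powr s * r powr s) / s"
      using s by (intro divide_right_mono) auto
    moreover have "- 2 * d powr s * (- (r powr (- ?q + 1)) / (- ?q + 1)) = - (d powr s / (r powr s * r powr s) / s)"
    proof -
      have "r powr (- ?q + 1) = 1 / (r powr s * r powr s)"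
        using powr_minus_divide[of r "2 * s"] powr_add[of r s s] by simp
      then show ?thesis using s by (simp add: field_simps)
    qed
    ultimately show ?thesis using r by (simp add: mult.commute)
  qed
  have A4: "- (4 / s) / r powr s + - (1 / s) / r powr s = - (5 / s) / r powr s"
    by (simp flip: add_divide_distrib)
  show "integral {\<rho>..} (\<lambda>\<tau>. h \<tau> / \<tau> powr ?q) \<ge> - (5 / s) / r powr s - 1 / (2 * s * d powr (2 - s)) * \<rho> powr (2 - 2 * s)"
    unfolding integral_unique[OF I] A4[symmetric]
    using add_mono[OF A1[unfolded A2] A3] by (simp only: diff_add_eq)
qed

text \<open>At a negative minimum of \<open>u - v\<close>, second differences of \<open>u\<close>
  dominate those of the barrier \<open>v\<close>, whose losses carry a factor \<open>c\<close>. The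
  gain does not: the inner ball lies on the radial line, and there \<open>u - v \<ge> m / 2\<close>.
  The constant is the same for all centres \<open>p\<close>.\<close>

lemma viscosity_supersolution_ball_barrier:
  fixes u :: "'a::euclidean_space \<Rightarrow> real"
  assumes s: "0 < s" "s < 1" and "open \<Omega>" and k: "k \<in> {1..DIM('a)}"
    and u: "viscosity_supersolution s k \<Omega> u" and nonneg: "\<And>z. u z \<ge> 0"
    and R: "0 < R" and m: "0 < m"
  obtains c where "0 < c" "\<And>p x. ball p R \<subseteq> \<Omega> \<Longrightarrow> (\<And>z. z \<in> cball p (R / 2) \<Longrightarrow> m \<le> u z) \<Longrightarrow>
    x \<in> ball p R \<Longrightarrow> c * cone_barrier p R s x \<le> u x"
proof -
  define q where "q = 1 + 2 * s"
  \<comment> \<open>\<open>P\<close> is the gain from the window \<open>{R / 2..R}\<close> of height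
    \<open>m / 2\<close>; \<open>Q\<close> collects the tangential and radial losses per unit of
    \<open>c\<close>, using \<open>r > R / 2\<close>.\<close>
  define P where "P = m / 2 * ((R - R / 2) / R powr q)"
  define Q where "Q = real k * 2 * kernel_const s / R powr s + (5 / s) / (R / 2) powr s"
  have P: "P > 0" using m R by (simp add: P_def)
  have Q: "Q \<ge> 0" using s R by (simp add: Q_def kernel_const_def)
  define w where "w = P / (Q + 1)"
  define c where "c = min w (m / R powr s) / 2"
  have c: "0 < c" "c * Q < P" "c * R powr s \<le> m / 2"
  proof -
    have pos: "w > 0" "m / R powr s > 0" using P Q m R by (auto simp: w_def)
    then show "0 < c" by (simp add: c_def)
    have "c \<le> w / 2" unfolding c_def by (intro divide_right_mono min.cobounded1) simp
    then have "c < w" using pos(1) by linarith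
    then have "c * (Q + 1) < P" using Q pos_less_divide_eq[of "Q + 1" c P] unfolding w_def by linarith
    then show "c * Q < P" using \<open>0 < c\<close> by (simp add: algebra_simps)
    have "c \<le> m / R powr s / 2" unfolding c_def by (intro divide_right_mono min.cobounded2) simp
    then show "c * R powr s \<le> m / 2" using R by (simp add: field_simps)
  qed
  have "c * cone_barrier p R s x \<le> u x"
    if p: "ball p R \<subseteq> \<Omega>" "\<And>z. z \<in> cball p (R / 2) \<Longrightarrow> m \<le> u z" and x: "x \<in> ball p R" for p x
  proof (rule ccontr)
    define v where "v = (\<lambda>z. c * cone_barrier p R s z)"
    assume "\<not> ?thesis"
    then have ux: "u x < v x" by (simp add: v_def)
    have v_le: "v z \<le> m / 2" for z
    proof -
      have "cone_barrier p R s z \<le> R powr s" using s R unfolding cone_barrier_def by (intro powr_mono2) auto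
      then have "v z \<le> c * R powr s" unfolding v_def using c(1) by (intro mult_left_mono) auto
      then show ?thesis using c(3) by simp
    qed
    have v_cont: "continuous_on UNIV v"
      unfolding v_def cone_barrier_def using s
      by (intro continuous_on_mult continuous_on_powr' continuous_on_const continuous_on_max
          continuous_on_diff continuous_on_dist continuous_on_id) auto
    \<comment> \<open>Near the sphere and outside it \<open>v\<close> is too small for the deficit
      at \<open>x\<close>, and \<open>u \<ge> 0\<close>. The minimum can therefore be sought on the
      smaller closed ball of radius \<open>R'\<close>, inside the domain where \<open>u\<close> is
      lower semicontinuous, and it is global.\<close>
    have v_near: "v z < v x - u x" if z: "R - ((v x - u x) / c) powr (1 / s) < dist z p" for z
    proof -
      have "max 0 (R - dist z p) < ((v x - u x) / c) powr (1 / s)" using z ux c(1) by simp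
      then have "max 0 (R - dist z p) powr s < (((v x - u x) / c) powr (1 / s)) powr s"
        by (rule powr_less_mono2[OF s(1) max.cobounded1])
      also have "\<dots> = (v x - u x) / c" using s ux c(1) by (simp add: powr_powr)
      finally show ?thesis using c(1) by (simp add: v_def cone_barrier_def field_simps)
    qed
    define R' where "R' = R - ((v x - u x) / c) powr (1 / s)"
    have R': "R' < R" using ux c(1) by (simp add: R'_def)
    have xR': "x \<in> cball p R'"
      using v_near[of x] nonneg[of x] by (force simp: R'_def dist_commute not_le[symmetric])
    have sub: "cball p R' \<subseteq> \<Omega>" using p(1) R' by auto
    have "lsc_on \<Omega> u" using u by (simp add: viscosity_supersolution_def)
    then have lsc: "lsc_on (cball p R') (\<lambda>z. u z + - v z)"
      by (intro lsc_on_add_continuous lsc_on_subset[OF _ sub] continuous_on_minus continuous_on_subset[OF v_cont]) auto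
    have "cball p R' \<noteq> {}" using xR' by blast
    then obtain y where y: "y \<in> cball p R'" "\<And>z. z \<in> cball p R' \<Longrightarrow> u y + - v y \<le> u z + - v z"
      using lsc_on_attains_min[OF lsc compact_cball] by blast
    have yx: "u y - v y \<le> u x - v x" using y(2)[OF xR'] by simp
    have glob: "u y - v y \<le> u z - v z" for z
    proof (cases "z \<in> cball p R'")
      case False
      then have "v z < v x - u x" using v_near[of z] by (simp add: R'_def dist_commute)
      then show ?thesis using yx nonneg[of z] by linarith
    qed (use y(2) in auto)
    have y\<Omega>: "y \<in> \<Omega>" using y(1) sub by blast
    define r where "r = dist y p"
    have r: "R / 2 < r" "r < R"
    proof -
      show "r < R" using y(1) R' by (simp add: r_def dist_commute)
      \<comment> \<open>In the inner ball \<open>u \<ge> m\<close> exceeds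
        \<open>v \<le> m / 2\<close>, so the contact point is not there.\<close>
      show "R / 2 < r"
      proof (rule ccontr)
        assume "\<not> R / 2 < r"
        then have "m \<le> u y" using p(2)[of y] by (simp add: r_def dist_commute)
        then show False using yx ux v_le[of y] m by linarith
      qed
    qed
    define d where "d = R - r"
    have d: "0 < d" "d \<le> r" using r by (auto simp: d_def)
    define e where "e = (1 / r) *\<^sub>R (y - p)"
    have e: "norm e = 1" "y = p + r *\<^sub>R e" using r R by (auto simp: e_def r_def dist_norm)
    obtain B where B: "B \<in> orthonormal_sets k" "e \<in> B"
      using orthonormal_set_containing[OF e(1) k] by blast
    have r0: "0 < r" using r R by simp
    obtain g M where M: "0 \<le> M" and touch: "\<And>h. norm h \<le> 1 \<Longrightarrow> cone_barrier p R s (y + h) \<ge>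
        cone_barrier p R s y + g \<bullet> h - M * (norm h)\<^sup>2"
      using cone_barrier_parabola_below[OF e(1) r0 r(2) s, of p] unfolding e(2)[symmetric] by metis
    have diff: "second_diff u y h \<ge> c * second_diff (cone_barrier p R s) y h" for h
      using glob[of "y + h"] glob[of "y - h"] by (simp add: second_diff_def v_def algebra_simps)
    define b where "b = c * (2 * d powr s)"
    define h where "h = (\<lambda>\<tau>. if \<tau> \<le> r then d powr s * ((1 + \<tau> / d) powr s + max 0 (1 - \<tau> / d) powr s - 2) else - 2 * d powr s)"
    have h_le: "h \<tau> \<le> second_diff (cone_barrier p R s) y (\<tau> *\<^sub>R e)" if "0 < \<tau>" for \<tau>
    proof (cases "\<tau> \<le> r")
      case True
      then show ?thesis
        using second_diff_cone_barrier_radial[OF e(1) r0 r(2), of \<tau> p s] that by (simp add: e(2)[symmetric] h_def d_def)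
    next
      case False
      moreover have "cone_barrier p R s y = d powr s"
        using r by (simp add: cone_barrier_def d_def r_def)
      ultimately show ?thesis
        by (simp add: second_diff_def h_def cone_barrier_def)
    qed
    have main: "second_diff u y (\<tau> *\<^sub>R e) - c * h \<tau> \<ge> - 0 * min 1 ((\<tau> / 1)\<^sup>2) + m / 2 * indicator {R / 2..R} \<tau>"
      if "0 < \<tau>" for \<tau>
    proof -
      have ch: "c * h \<tau> \<le> c * second_diff (cone_barrier p R s) y (\<tau> *\<^sub>R e)"
        using h_le[OF that] c(1) by (intro mult_left_mono) auto
      show ?thesis
      proof (cases "\<tau> \<in> {R / 2..R}")
        case True
        \<comment> \<open>Going inwards by \<tau> in \<open>{R / 2..R}\<close> lands in the inner
          ball because \<open>R / 2 < r < R\<close>.\<close>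
        have "y - \<tau> *\<^sub>R e - p = (r - \<tau>) *\<^sub>R e" unfolding e(2) by (simp add: algebra_simps)
        then have "dist (y - \<tau> *\<^sub>R e) p = \<bar>r - \<tau>\<bar>" using e(1) by (simp add: dist_norm)
        then have "dist p (y - \<tau> *\<^sub>R e) = \<bar>r - \<tau>\<bar>" by (simp only: dist_commute)
        moreover have "\<bar>r - \<tau>\<bar> \<le> R / 2"
        proof (rule abs_leI)
          show "r - \<tau> \<le> R / 2" "- (r - \<tau>) \<le> R / 2" using True r by auto
        qed
        ultimately have "m \<le> u (y - \<tau> *\<^sub>R e)" by (intro p(2)) simp
        then have "u (y - \<tau> *\<^sub>R e) - v (y - \<tau> *\<^sub>R e) \<ge> m / 2 + (u y - v y)"
          using v_le[of "y - \<tau> *\<^sub>R e"] yx ux by linarith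
        then have "second_diff u y (\<tau> *\<^sub>R e) \<ge> c * second_diff (cone_barrier p R s) y (\<tau> *\<^sub>R e) + m / 2"
          using glob[of "y + \<tau> *\<^sub>R e"] by (simp add: second_diff_def v_def algebra_simps)
        then show ?thesis using ch True by simp
      next
        case False
        then show ?thesis using ch diff[of "\<tau> *\<^sub>R e"] by simp
      qed
    qed
    define E where "E = c * (1 / (2 * s * d powr (2 - s)))"
    have "P - c * ((5 / s) / r powr s) \<le> real k * b * (kernel_const s / sqrt (2 * r * d) powr (2 * s))"
    \<comment> \<open>The step bound 1 is the range of the touching paraboloid, \<open>d / 2\<close>
      that of the radial estimate.\<close>
    proof (rule viscosity_supersolution_limit[OF s u y\<Omega> _ B, where E = E and r = "min 1 (d / 2)" and M = "c * M" and p = "c *\<^sub>R g"])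
      fix z assume "dist z y < min 1 (d / 2)"
      then have "norm (z - y) \<le> 1" by (simp add: dist_norm)
      then have "v z \<ge> c * (cone_barrier p R s y + g \<bullet> (z - y) - M * (norm (z - y))\<^sup>2)"
        using touch[of "z - y"] c(1) unfolding v_def by (intro mult_left_mono) auto
      then show "u y + c *\<^sub>R g \<bullet> (z - y) - c * M * (norm (z - y))\<^sup>2 \<le> u z"
        using glob[of z] by (simp add: v_def algebra_simps)
    next
      fix \<xi> \<tau> assume \<xi>: "\<xi> \<in> B - {e}" and "(0::real) < \<tau>"
      then have "norm \<xi> = 1" "orthogonal e \<xi>"
        using B by (auto simp: orthonormal_sets_def pairwise_def)
      then have "c * second_diff (cone_barrier p R s) y (\<tau> *\<^sub>R \<xi>) \<ge>
          c * (- (2 * d powr s) * min 1 ((\<tau> / sqrt (2 * r * d))\<^sup>2))"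
        using second_diff_cone_barrier_tangential[OF e(1) r0 r(2) s, where \<xi> = \<xi> and p = p and \<tau> = \<tau>] c(1)
        unfolding e(2)[symmetric] d_def[symmetric] by (intro mult_left_mono) auto
      then show "- b * min 1 ((\<tau> / sqrt (2 * r * d))\<^sup>2) \<le> second_diff u y (\<tau> *\<^sub>R \<xi>)"
        using diff[of "\<tau> *\<^sub>R \<xi>"] by (simp add: b_def mult.assoc)
    next
      let ?D = "\<lambda>\<tau>. second_diff u y (\<tau> *\<^sub>R e)"
      fix \<rho> assume "0 < \<rho>" "\<rho> \<le> min 1 (d / 2)"
        and int: "(\<lambda>\<tau>. ?D \<tau> / \<tau> powr (1 + 2 * s)) integrable_on {\<rho>..}"
      then have \<rho>: "0 < \<rho>" "\<rho> \<le> d / 2" "\<rho> \<le> R / 2" using d r by auto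
      have H: "(\<lambda>\<tau>. h \<tau> / \<tau> powr (1 + 2 * s)) integrable_on {\<rho>..}"
        "integral {\<rho>..} (\<lambda>\<tau>. h \<tau> / \<tau> powr (1 + 2 * s)) \<ge>
           - (5 / s) / r powr s - 1 / (2 * s * d powr (2 - s)) * \<rho> powr (2 - 2 * s)"
        unfolding h_def by (rule integral_radial_profile[OF s d \<rho>(1,2)])+
      have eq: "(\<lambda>\<tau>. (?D \<tau> - c * h \<tau>) / \<tau> powr (1 + 2 * s)) =
          (\<lambda>\<tau>. ?D \<tau> / \<tau> powr (1 + 2 * s) - c * (h \<tau> / \<tau> powr (1 + 2 * s)))"
        by (simp add: diff_divide_distrib)
      have int': "(\<lambda>\<tau>. (?D \<tau> - c * h \<tau>) / \<tau> powr (1 + 2 * s)) integrable_on {\<rho>..}"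
        unfolding eq by (intro integrable_diff int integrable_on_mult_right H)
      have "P \<le> integral {\<rho>..} (\<lambda>\<tau>. (?D \<tau> - c * h \<tau>) / \<tau> powr (1 + 2 * s))"
        using integral_kernel_lower_bound[OF s zero_less_one order_refl _ \<rho>(1,3) _ int', of "m / 2" R] main \<rho> m R
        by (simp add: P_def q_def)
      also have "\<dots> = integral {\<rho>..} (\<lambda>\<tau>. ?D \<tau> / \<tau> powr (1 + 2 * s)) -
          c * integral {\<rho>..} (\<lambda>\<tau>. h \<tau> / \<tau> powr (1 + 2 * s))"
        unfolding eq by (simp only: integral_diff[OF int integrable_on_mult_right[OF H(1)]] integral_mult_right)
      finally have "integral {\<rho>..} (\<lambda>\<tau>. ?D \<tau> / \<tau> powr (1 + 2 * s)) \<ge>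
          P + c * integral {\<rho>..} (\<lambda>\<tau>. h \<tau> / \<tau> powr (1 + 2 * s))" by simp
      moreover have "c * integral {\<rho>..} (\<lambda>\<tau>. h \<tau> / \<tau> powr (1 + 2 * s)) \<ge>
          c * (- (5 / s) / r powr s - 1 / (2 * s * d powr (2 - s)) * \<rho> powr (2 - 2 * s))"
        using H(2) c(1) by (intro mult_left_mono) auto
      moreover have "c * (- (5 / s) / r powr s - 1 / (2 * s * d powr (2 - s)) * \<rho> powr (2 - 2 * s)) =
          - (c * ((5 / s) / r powr s)) - E * \<rho> powr (2 - 2 * s)"
        by (simp add: E_def right_diff_distrib)
      ultimately show "P - c * ((5 / s) / r powr s) - E * \<rho> powr (2 - 2 * s) \<le>
          integral {\<rho>..} (\<lambda>\<tau>. ?D \<tau> / \<tau> powr (1 + 2 * s))" by linarith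
    qed (use d r0 c(1) in \<open>auto simp: b_def\<close>)
    moreover have "real k * b * (kernel_const s / sqrt (2 * r * d) powr (2 * s)) \<le>
        c * (real k * 2 * kernel_const s / R powr s)"
    proof -
      \<comment> \<open>The factor \<open>d powr s\<close> cancels the one in \<open>b\<close>, so
        the tangential loss is uniform up to the boundary.\<close>
      have "sqrt (2 * r * d) powr (2 * s) = (sqrt (2 * r * d))\<^sup>2 powr s"
        using powr_powr[of "sqrt (2 * r * d)" 2 s] r0 d by simp
      also have "\<dots> = (2 * r) powr s * d powr s" using r0 d by (simp add: powr_mult)
      finally have sq: "sqrt (2 * r * d) powr (2 * s) = (2 * r) powr s * d powr s" .
      have "R powr s \<le> (2 * r) powr s" using r R s by (intro powr_mono2) auto
      then have "real k * 2 * kernel_const s / (2 * r) powr s \<le> real k * 2 * kernel_const s / R powr s"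
        using R r0 s by (intro divide_left_mono) (auto simp: kernel_const_def)
      then have "c * (real k * 2 * kernel_const s / (2 * r) powr s) \<le> c * (real k * 2 * kernel_const s / R powr s)"
        using c(1) by (intro mult_left_mono) auto
      then show ?thesis unfolding sq b_def using d by (simp add: mult.commute mult.left_commute)
    qed
    moreover have "c * ((5 / s) / r powr s) \<le> c * ((5 / s) / (R / 2) powr s)"
      using c(1) s r R by (intro mult_left_mono divide_left_mono powr_mono2) auto
    ultimately have "P \<le> c * Q" by (simp add: Q_def distrib_left)
    then show False using c(2) by simp
  qed
  then show ?thesis using that c(1) by blast
qed

section \<open>Combination of the compact inner part with the boundary layer\<close>

theorem corollary4p10:
  fixes s :: real and k :: nat and \<Omega> :: "'a::euclidean_space set" and u :: "'a \<Rightarrow> real"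
  assumes "0 < s" "s < 1"
    and "C2_domain \<Omega>" "bounded \<Omega>"
    and "k \<in> {1..DIM('a)}"
    and "viscosity_supersolution s k \<Omega> u"
    and "\<forall>x\<in>- \<Omega>. u x \<ge> 0"
    and "\<exists>x\<in>\<Omega>. u x \<noteq> 0"
  shows "\<exists>c>0. \<forall>x\<in>closure \<Omega>. u x \<ge> c * infdist x (frontier \<Omega>) powr s"
proof -
  have op: "open \<Omega>" using assms(3) by (simp add: C2_domain_def)
  have nonneg: "u z \<ge> 0" for z
    by (rule viscosity_supersolution_nonneg[OF assms(1-7)])
  have pos: "u z > 0" if "z \<in> \<Omega>" for z
    using viscosity_supersolution_pos[OF assms(1,2) op assms(5,6) nonneg _ _ that] assms(8) by blast
  obtain R where R: "R > 0" "\<And>z. z \<in> frontier \<Omega> \<Longrightarrow> ball_condition \<Omega> R z"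
    using C2_domain_ball_condition[OF assms(3,4)] by blast
  let ?d = "\<lambda>x. infdist x (frontier \<Omega>)"
  have fr: "frontier \<Omega> \<noteq> {}"
    using assms(8) op assms(4) not_bounded_UNIV by (auto simp: frontier_eq_empty)
  \<comment> \<open>The points at depth at least \<open>R / 2\<close> form a compact subset of the
    domain, on which \<open>u\<close> has a positive lower bound \<open>m\<close>.\<close>
  define K where "K = {x \<in> closure \<Omega>. R / 2 \<le> ?d x}"
  have "K = closure \<Omega> \<inter> {x. R / 2 \<le> ?d x}" by (auto simp: K_def)
  then have "compact K"
    using assms(4) by (auto intro!: compact_Int_closed closed_Collect_le continuous_intros)
  have K\<Omega>: "K \<subseteq> \<Omega>"
  proof
    fix x assume x: "x \<in> K"
    show "x \<in> \<Omega>"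
    proof (rule ccontr)
      assume "x \<notin> \<Omega>"
      then have "x \<in> frontier \<Omega>" using x op by (simp add: K_def frontier_def interior_open)
      then show False using x R by (simp add: K_def)
    qed
  qed
  obtain m where m: "0 < m" "\<And>z. z \<in> K \<Longrightarrow> m \<le> u z"
  proof (cases "K = {}")
    case False
    have "lsc_on K u"
      using assms(6) lsc_on_subset[OF _ K\<Omega>] by (auto simp: viscosity_supersolution_def)
    then obtain y where "y \<in> K" "\<And>z. z \<in> K \<Longrightarrow> u y \<le> u z"
      using lsc_on_attains_min[OF _ \<open>compact K\<close> False] by blast
    then show ?thesis using that[of "u y"] pos K\<Omega> by blast
  qed (use that[of 1] in auto)
  obtain c where c: "0 < c" and barrier: "\<And>p x. ball p R \<subseteq> \<Omega> \<Longrightarrow> (\<And>z. z \<in> cball p (R / 2) \<Longrightarrow> m \<le> u z) \<Longrightarrow>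
    x \<in> ball p R \<Longrightarrow> c * cone_barrier p R s x \<le> u x"
    using viscosity_supersolution_ball_barrier[OF assms(1,2) op assms(5,6) nonneg R(1) m(1)] by blast
  obtain D where D: "D > 0" "\<And>x. x \<in> K \<Longrightarrow> ?d x \<le> D"
  proof -
    have "bounded (?d ` K)"
      by (intro compact_imp_bounded compact_continuous_image \<open>compact K\<close> continuous_intros)
    then obtain D where "D > 0" "\<And>y. y \<in> ?d ` K \<Longrightarrow> norm y \<le> D" by (auto simp: bounded_pos)
    then show ?thesis using that[of D] by force
  qed
  \<comment> \<open>The first entry serves the boundary layer, the second the set \<open>K\<close>,
    where the distance is at most \<open>D\<close>.\<close>
  define c' where "c' = min c (m / D powr s)"
  have "c' * ?d x powr s \<le> u x" if x: "x \<in> closure \<Omega>" for x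
  proof (cases "x \<in> \<Omega>")
    case False
    \<comment> \<open>On the frontier the bound reads \<open>u x \<ge> 0\<close>, since
      \<open>0 powr s = 0\<close>.\<close>
    then have "?d x = 0" using x op by (simp add: frontier_def interior_open)
    then show ?thesis using nonneg by simp
  next
    case x\<Omega>: True
    show ?thesis
    proof (cases "R / 2 \<le> ?d x")
      case True
      then have xK: "x \<in> K" using x by (simp add: K_def)
      have "c' * ?d x powr s \<le> m / D powr s * D powr s"
        using D(2)[OF xK] D(1) m(1) assms(1) infdist_nonneg by (intro mult_mono powr_mono2) (auto simp: c'_def)
      also have "\<dots> = m" using D(1) by simp
      finally show ?thesis using m(2)[OF xK] by simp
    next
      case False
      obtain z where z: "z \<in> frontier \<Omega>" "?d x = dist x z"
        using infdist_attains_inf[OF frontier_closed fr] by metis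
      obtain e where e: "norm e = 1" "ball (z + R *\<^sub>R e) R \<subseteq> \<Omega>" "ball (z - R *\<^sub>R e) R \<subseteq> - \<Omega>"
        using R(2)[OF z(1)] by (auto simp: ball_condition_def)
      \<comment> \<open>The centre of the interior ball tangent at the nearest boundary point. As
        \<open>x\<close> lies on the radius from \<open>z\<close> to \<open>p\<close>, its distance
        to the sphere equals its distance to the boundary.\<close>
      define p where "p = z + R *\<^sub>R e"
      have d0: "0 < dist x z" using z(1) x\<Omega> op by (auto simp: frontier_def interior_open)
      have "x = z + dist x z *\<^sub>R e"
        by (rule nearest_point_inward_normal[OF x\<Omega> z R(1) d0 e(1,3)])
      then have "x - p = (dist x z - R) *\<^sub>R e" by (simp add: p_def algebra_simps)
      then have xp: "dist x p = R - dist x z" using e(1) False z(2) R(1) by (simp add: dist_norm[of x p])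
      have "z' \<in> K" if z': "z' \<in> cball p (R / 2)" for z'
      proof -
        \<comment> \<open>The centre has depth at least \<open>R\<close>, so the concentric ball of
          radius \<open>R / 2\<close> lies in \<open>K\<close>, which supplies the bound
          \<open>m\<close> that the barrier requires.\<close>
        have pR: "R \<le> ?d p"
        proof (rule ccontr)
          assume "\<not> R \<le> ?d p"
          obtain w where w: "w \<in> frontier \<Omega>" "?d p = dist p w"
            using infdist_attains_inf[OF frontier_closed fr] by metis
          then have "w \<in> ball p R" using \<open>\<not> R \<le> ?d p\<close> by simp
          then have "w \<in> \<Omega>" using e(2) by (auto simp: p_def)
          then show False using w(1) op by (simp add: frontier_def interior_open)
        qed
        have "?d p \<le> ?d z' + dist p z'" by (rule infdist_triangle)
        then have "R / 2 \<le> ?d z'" using pR z' by simp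
        moreover have "z' \<in> ball p R" using z' R(1) by simp
        then have "z' \<in> closure \<Omega>" using e(2) closure_subset unfolding p_def by blast
        ultimately show ?thesis by (simp add: K_def)
      qed
      then have "c * cone_barrier p R s x \<le> u x"
        using barrier[of p x] e(2) m(2) xp d0 by (simp add: p_def dist_commute)
      moreover have "cone_barrier p R s x = ?d x powr s"
        using xp z(2) by (simp add: cone_barrier_def)
      moreover have "c' * ?d x powr s \<le> c * ?d x powr s" by (intro mult_right_mono) (auto simp: c'_def)
      ultimately show ?thesis by simp
    qed
  qed
  moreover have "c' > 0" using c m D by (simp add: c'_def)
  ultimately show ?thesis by blast
qed

end
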